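(* Let $f(z)=\sum_{\alpha\in A}a_\alpha z^\alpha$ be a complex Laurent polynomial in $n$ variables, where $A\subset\mathbb{Z}^n$ is a finite set and $a_\alpha\in\mathbb{C}\setminus\{0\}$ for all $\alpha\in A$, let $\Delta_f$ be its Newton polytope and $\mathcal{A}'_f\subset\mathbb{R}^n$ its coamoeba. For any connected component $E$ of the coamoeba complement $\mathbb{R}^n\setminus\overline{\mathcal{A}'_f}$ there is an integral representation $$\frac{1}{f(z)}=\int_{\sigma+i\mathbb{R}^n}M^E_{1/f}(s)\,z^{-s}\,ds,$$ which converges for all $z$ in the domain $\operatorname{Arg}^{-1}(E)$. Here $\sigma$ is an arbitrary point in $\operatorname{int}\Delta_f$ and $$M^E_{1/f}(s)=\frac{1}{(2\pi i)^n}\int_{\operatorname{Arg}^{-1}(\theta)}\frac{z^{s}}{f(z)}\frac{dz}{z}=\frac{1}{(2\pi i)^n}\int_{\mathbb{R}^n}\frac{e^{\langle s,x+i\theta\rangle}}{f(e^{x+i\theta})}\,dx,$$ with $\theta$ being an arbitrary point in the component $E$ (the value $M^E_{1/f}(s)$ not depending on the choice of $\theta\in E$).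
   Context: Notation: $z^\alpha=z_1^{\alpha_1}\cdots z_n^{\alpha_n}$; $e^{w}=(e^{w_1},\ldots,e^{w_n})$ for $w\in\mathbb{C}^n$; $\langle s,w\rangle=\sum_js_jw_j$; $dz/z=dz_1\wedge\cdots\wedge dz_n/(z_1\cdots z_n)$; $ds=ds_1\cdots ds_n$, so that $ds=i^n\,dt_1\cdots dt_n$ on $s=\sigma+it$, $t\in\mathbb{R}^n$. The Newton polytope $\Delta_f$ is the convex hull of $A$ in $\mathbb{R}^n$, and $\operatorname{int}\Delta_f$ is its interior in $\mathbb{R}^n$. The coamoeba is $\mathcal{A}'_f=\operatorname{Arg}(Z_f)$, where $Z_f=\{z\in(\mathbb{C}\setminus\{0\})^n\,;\ f(z)=0\}$ and $\operatorname{Arg}(z)=(\arg z_1,\ldots,\arg z_n)$ is multivalued; the coamoeba is regarded as a $2\pi\mathbb{Z}^n$-periodic subset of $\mathbb{R}^n$, i.e. $\mathcal{A}'_f=\{\theta\in\mathbb{R}^n\,;\ f(e^{x+i\theta})=0\text{ for some }x\in\mathbb{R}^n\}$, and $\overline{\mathcal{A}'_f}$ is its closure in $\mathbb{R}^n$. For $\theta\in\mathbb{R}^n$, $\operatorname{Arg}^{-1}(\theta)=\{e^{x+i\theta}\,;\ x\in\mathbb{R}^n\}$, and $\operatorname{Arg}^{-1}(E)=\{e^{x+i\theta}\,;\ x\in\mathbb{R}^n,\ \theta\in E\}$. Powers are taken with the branch of the argument lying in $E$: for $z=e^{x+i\theta}$ with $\theta\in E$, $z^{s}=e^{\langle s,x+i\theta\rangle}$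 and $z^{-s}=e^{-\langle s,x+i\theta\rangle}$. *)

theory Defs
  imports "HOL-Analysis.Analysis"
begin

definition laurent_poly :: "(int ^ 'n) set \<Rightarrow> (int ^ 'n \<Rightarrow> complex) \<Rightarrow> complex ^ 'n \<Rightarrow> complex" where
  "laurent_poly A a z = (\<Sum>\<alpha>\<in>A. a \<alpha> * (\<Prod>j\<in>UNIV. (z $ j) powi (\<alpha> $ j)))"

definition newton_polytope :: "(int ^ 'n) set \<Rightarrow> (real ^ 'n) set" where
  "newton_polytope A = convex hull ((\<lambda>\<alpha>. \<chi> j. real_of_int (\<alpha> $ j)) ` A)"

definition cvec :: "real ^ 'n \<Rightarrow> real ^ 'n \<Rightarrow> complex ^ 'n" where
  "cvec x y = (\<chi> j. Complex (x $ j) (y $ j))"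

definition exp_vec :: "complex ^ 'n \<Rightarrow> complex ^ 'n" where
  "exp_vec w = (\<chi> j. exp (w $ j))"

text \<open>The pairing is bilinear over the complex numbers, without conjugation; the library's inner
  product on the same type is real-valued.\<close>

definition cpairing :: "complex ^ 'n \<Rightarrow> complex ^ 'n \<Rightarrow> complex" where
  "cpairing s w = (\<Sum>j\<in>UNIV. s $ j * w $ j)"

definition Arg_fiber :: "real ^ 'n \<Rightarrow> (complex ^ 'n) set" where
  "Arg_fiber \<theta> = range (\<lambda>x. exp_vec (cvec x \<theta>))"

definition torus_zeros :: "(complex ^ 'n \<Rightarrow> complex) \<Rightarrow> (complex ^ 'n) set" where
  "torus_zeros f = {z. (\<forall>j. z $ j \<noteq> 0) \<and> f z = 0}"

text \<open>All values of the multivalued argument are collected, so the coamoeba is a periodic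
  subset of the whole space.\<close>

definition coamoeba :: "(complex ^ 'n \<Rightarrow> complex) \<Rightarrow> (real ^ 'n) set" where
  "coamoeba f = {\<theta>. Arg_fiber \<theta> \<inter> torus_zeros f \<noteq> {}}"

text \<open>The power of \<open>z\<close> with exponent vector \<open>s\<close>, for \<open>z\<close> in the fibre of \<open>Arg\<close> over \<open>\<theta>\<close>, with
  \<open>\<theta>\<close> as the value of the argument: at \<open>z = exp_vec (cvec x \<theta>)\<close> it is
  \<open>exp (cpairing s (cvec x \<theta>))\<close>.\<close>

definition branch_power :: "real ^ 'n \<Rightarrow> complex ^ 'n \<Rightarrow> complex ^ 'n \<Rightarrow> complex" where
  "branch_power \<theta> z s = exp (cpairing s (cvec (\<chi> j. ln (norm (z $ j))) \<theta>))"

text \<open>Integration of the holomorphic form with coefficient \<open>g\<close> (with respect to the wedge product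
  of the coordinate differentials) over the \<open>n\<close>-chain parametrised by \<open>\<gamma>\<close>: the pullback multiplies
  by the complex Jacobian determinant. Convergence means Lebesgue integrability.\<close>

definition form_pullback ::
  "(real ^ 'n \<Rightarrow> complex ^ 'n) \<Rightarrow> (complex ^ 'n \<Rightarrow> complex) \<Rightarrow> real ^ 'n \<Rightarrow> complex" where
  "form_pullback \<gamma> g x =
     g (\<gamma> x) * det (\<chi> j k. vector_derivative (\<lambda>h. \<gamma> (x + h *\<^sub>R axis k 1) $ j) (at 0))"

definition form_integrable ::
  "(real ^ 'n \<Rightarrow> complex ^ 'n) \<Rightarrow> (complex ^ 'n \<Rightarrow> complex) \<Rightarrow> bool" where
  "form_integrable \<gamma> g \<longleftrightarrow> integrable lborel (form_pullback \<gamma> g)"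

definition form_integral ::
  "(real ^ 'n \<Rightarrow> complex ^ 'n) \<Rightarrow> (complex ^ 'n \<Rightarrow> complex) \<Rightarrow> complex" where
  "form_integral \<gamma> g = (LINT x|lborel. form_pullback \<gamma> g x)"

definition mellin_form ::
  "(complex ^ 'n \<Rightarrow> complex) \<Rightarrow> real ^ 'n \<Rightarrow> complex ^ 'n \<Rightarrow> complex ^ 'n \<Rightarrow> complex" where
  "mellin_form f \<theta> s z = branch_power \<theta> z s / f z / (\<Prod>j\<in>UNIV. z $ j)"

end

theory Submission
  imports Defs "HOL-Complex_Analysis.Great_Picard"
    "HOL-Probability.Characteristic_Functions" "HOL-Probability.Sinc_Integral"
begin

text \<open>
  Near a point \<open>\<theta>\<close> outside the closed coamoeba, \<open>f\<close> restricted to a complex line through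
  \<open>x + i \<theta>\<close> with generic real direction is an exponential sum without zeros in a disc of fixed
  radius. Normalising the coefficients, a compactness argument with Hurwitz's theorem gives a bound
  \<open>\<bar>f(e\<^bsup>x+i\<theta>\<^esup>)\<bar> \<ge> c e\<^bsup>\<langle>\<alpha>,x\<rangle>\<^esup>\<close> for all exponents \<open>\<alpha>\<close>, uniform in \<open>x\<close> and locally uniform in \<open>\<theta>\<close>. For
  \<open>\<sigma>\<close> in the interior of the Newton polytope the integrand of the Mellin transform therefore decays
  exponentially in \<open>x\<close>. Shifting \<open>\<theta>\<close> does not change the Mellin transform, so a shift against \<open>t\<close>
  shows that it decays in \<open>t = Im s\<close> as well, and the representation of \<open>1/f\<close> is the Fourier
  inversion formula.
\<close>

section \<open>Exponential sums in one complex variable\<close>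

text \<open>Induction on the index set: dividing by \<open>exp (l k * z)\<close> makes the
  \<open>k\<close>-th term constant, so differentiation removes it and multiplies the other
  coefficients by the nonzero numbers \<open>l j - l k\<close>.\<close>

lemma exp_sum_eq_0_imp_coeff_eq_0:
  fixes l b :: "'i \<Rightarrow> complex"
  assumes "finite A" "inj_on l A" "r > 0"
    and "\<And>z. z \<in> ball 0 r \<Longrightarrow> (\<Sum>i\<in>A. b i * exp (l i * z)) = 0"
    and "i \<in> A"
  shows "b i = 0"
  using assms
proof (induction A arbitrary: b i rule: finite_induct)
  case empty
  then show ?case by simp
next
  case (insert k A)
  let ?g = "\<lambda>z. b k + (\<Sum>j\<in>A. b j * exp ((l j - l k) * z))"
  have g0: "?g z = 0" if "z \<in> ball 0 r" for z
  proof -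
    have "?g z = exp (- l k * z) * (\<Sum>i\<in>insert k A. b i * exp (l i * z))"
      using insert.hyps
      by (simp add: algebra_simps sum_distrib_left flip: exp_add)
    then show ?thesis using insert.prems(3)[OF that] by simp
  qed
  have dg: "(\<Sum>j\<in>A. (b j * (l j - l k)) * exp (l j * z)) = 0" if z: "z \<in> ball 0 r" for z
  proof -
    have "(?g has_field_derivative (\<Sum>j\<in>A. b j * (exp ((l j - l k) * z) * (l j - l k)))) (at z)"
      by (auto intro!: derivative_eq_intros sum.cong simp: mult_ac)
    moreover have "(?g has_field_derivative 0) (at z)"
      by (rule has_field_derivative_transform_within_open[of "\<lambda>_. 0" _ _ "ball 0 r"])
         (use z g0 in auto)
    ultimately have "(\<Sum>j\<in>A. b j * (exp ((l j - l k) * z) * (l j - l k))) = 0"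
      by (rule DERIV_unique)
    then have "exp (l k * z) * (\<Sum>j\<in>A. b j * (exp ((l j - l k) * z) * (l j - l k))) = 0"
      by simp
    then show ?thesis
      by (simp add: sum_distrib_left algebra_simps flip: exp_add)
  qed
  have bj: "b j = 0" if "j \<in> A" for j
  proof -
    have "b j * (l j - l k) = 0"
      using insert.IH[of "\<lambda>j. b j * (l j - l k)" j] insert.prems(1,2) dg that by simp
    moreover have "l j \<noteq> l k"
      using insert.prems(1) insert.hyps that by (metis inj_on_insert insert_Diff_single
          image_eqI insertCI Diff_insert_absorb)
    ultimately show ?thesis by simp
  qed
  have "b k = 0" using g0[of 0] bj insert.prems(2) by simp
  with bj insert.prems(4) show ?case by auto
qed

text \<open>Bolzano-Weierstrass is applied to one index at a time, each time refining the previous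
  subsequence.\<close>

lemma convergent_subsequence_finite_family:
  fixes u :: "nat \<Rightarrow> 'i \<Rightarrow> 'a :: {heine_borel, real_normed_vector}"
  assumes "finite A" "\<And>n i. i \<in> A \<Longrightarrow> norm (u n i) \<le> B"
  shows "\<exists>(s::nat \<Rightarrow> nat) d. strict_mono s \<and> (\<forall>i\<in>A. (\<lambda>n. u (s n) i) \<longlonglongrightarrow> d i)"
  using assms
proof (induction A rule: finite_induct)
  case empty
  show ?case by (rule exI[of _ id]) (simp add: strict_mono_def)
next
  case (insert k A)
  then obtain s d where s: "strict_mono (s :: nat \<Rightarrow> nat)"
    and d: "\<And>i. i \<in> A \<Longrightarrow> (\<lambda>n. u (s n) i) \<longlonglongrightarrow> d i" by (metis insertCI)
  have "bounded (range (\<lambda>n. u (s n) k))"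
    using insert.prems by (auto simp: bounded_iff)
  from bounded_imp_convergent_subsequence[OF this] obtain l q
    where q: "strict_mono (q :: nat \<Rightarrow> nat)" and l: "((\<lambda>n. u (s n) k) \<circ> q) \<longlonglongrightarrow> l" by auto
  have "(\<lambda>n. u ((s \<circ> q) n) i) \<longlonglongrightarrow> (d(k := l)) i" if "i \<in> insert k A" for i
    using that l insert.hyps d[THEN LIMSEQ_subseq_LIMSEQ[OF _ q]] by (auto simp: o_def)
  then show ?case using strict_mono_o[OF s q] by blast
qed

lemma uniform_limit_sum:
  fixes f :: "'i \<Rightarrow> 'a \<Rightarrow> 'b \<Rightarrow> 'c::real_normed_vector"
  assumes "finite A" "\<And>i. i \<in> A \<Longrightarrow> uniform_limit K (f i) (g i) F"
  shows "uniform_limit K (\<lambda>n z. \<Sum>i\<in>A. f i n z) (\<lambda>z. \<Sum>i\<in>A. g i z) F"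
  using assms
proof (induction A rule: finite_induct)
  case empty
  show ?case using uniform_limit_const[where c = "\<lambda>_. 0"] by simp
next
  case (insert i A)
  then show ?case by (simp add: uniform_limit_add)
qed

text \<open>If no \<open>c\<close> worked, normalised coefficient vectors of zero-free sums would
  have a limit whose sum vanishes at 0, which Hurwitz's theorem forbids. That \<open>c\<close>
  depends only on \<open>A\<close>, the frequencies and the radius, not on \<open>b\<close>, is what
  later gives bounds uniform in \<open>x\<close> and \<open>\<theta>\<close>.\<close>

lemma exp_sum_lower_bound:
  fixes l :: "'i \<Rightarrow> complex"
  assumes A: "finite A" and inj: "inj_on l A" and r: "r > 0"
  obtains c :: real where "c > 0"
    and "\<And>b. (\<And>z. z \<in> ball 0 r \<Longrightarrow> (\<Sum>i\<in>A. b i * exp (l i * z)) \<noteq> 0) \<Longrightarrow>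
           c * (\<Sum>i\<in>A. norm (b i)) \<le> norm (\<Sum>i\<in>A. b i)"
proof (rule ccontr)
  let ?nz = "\<lambda>b. \<forall>z\<in>ball 0 r. (\<Sum>i\<in>A. b i * exp (l i * z)) \<noteq> 0"
  assume "\<not> thesis"
  then have "\<forall>c>0. \<exists>b. ?nz b \<and> norm (\<Sum>i\<in>A. b i) < c * (\<Sum>i\<in>A. norm (b i))"
    using that by (metis not_le)
  then have "\<forall>n. \<exists>b. ?nz b \<and> norm (\<Sum>i\<in>A. b i) < (1 / Suc n) * (\<Sum>i\<in>A. norm (b i))"
    by (metis zero_less_divide_1_iff of_nat_0_less_iff zero_less_Suc)
  then obtain b where nz: "\<And>n. ?nz (b n)"
    and small: "\<And>n. norm (\<Sum>i\<in>A. b n i) < (1 / Suc n) * (\<Sum>i\<in>A. norm (b n i))"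
    by metis
  define S where "S n = (\<Sum>i\<in>A. norm (b n i))" for n
  \<comment> \<open>The strict inequality \<open>small\<close> is impossible for vanishing
    coefficients, so they can be normalised to have absolute sum 1.\<close>
  have S: "S n > 0" for n
    using le_less_trans[OF norm_ge_zero small[of n]]
    by (simp add: S_def zero_less_mult_iff zero_less_divide_iff)
  define u where "u n i = b n i / of_real (S n)" for n i
  have norm_u: "(\<Sum>i\<in>A. norm (u n i)) = 1" for n
    using S[of n] by (simp add: u_def norm_divide flip: sum_divide_distrib) (simp add: S_def)
  have sum_u: "norm (\<Sum>i\<in>A. u n i) < 1 / Suc n" for n
    using small[of n] S[of n]
    by (simp add: u_def norm_divide flip: sum_divide_distrib) (simp add: S_def field_simps)
  have nz_u: "(\<Sum>i\<in>A. u n i * exp (l i * z)) \<noteq> 0" if "z \<in> ball 0 r" for n z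
  proof -
    have "(\<Sum>i\<in>A. u n i * exp (l i * z)) = (\<Sum>i\<in>A. b n i * exp (l i * z)) / of_real (S n)"
      by (simp add: u_def sum_divide_distrib)
    then show ?thesis using nz[of n] that S[of n] by simp
  qed
  have "norm (u n i) \<le> 1" if "i \<in> A" for n i
    using norm_u[of n] member_le_sum[of i A "\<lambda>i. norm (u n i)"] that A by simp
  from convergent_subsequence_finite_family[of A u, OF A this]
  obtain s d where s: "strict_mono (s :: nat \<Rightarrow> nat)"
    and d: "\<And>i. i \<in> A \<Longrightarrow> (\<lambda>n. u (s n) i) \<longlonglongrightarrow> d i" by auto
  let ?g = "\<lambda>z. \<Sum>i\<in>A. d i * exp (l i * z)"
  have "(\<lambda>n. \<Sum>i\<in>A. norm (u (s n) i)) \<longlonglongrightarrow> (\<Sum>i\<in>A. norm (d i))"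
    by (intro tendsto_sum tendsto_norm d)
  then have norm_d: "(\<Sum>i\<in>A. norm (d i)) = 1"
    by (simp add: norm_u LIMSEQ_const_iff)
  have "(\<lambda>n. \<Sum>i\<in>A. u (s n) i) \<longlonglongrightarrow> (\<Sum>i\<in>A. d i)"
    by (intro tendsto_sum d)
  moreover have "(\<lambda>n. \<Sum>i\<in>A. u (s n) i) \<longlonglongrightarrow> 0"
  proof (rule Lim_null_comparison)
    show "\<forall>\<^sub>F n in sequentially. norm (\<Sum>i\<in>A. u (s n) i) \<le> 1 / real (Suc (s n))"
      using sum_u by (intro always_eventually) (auto intro: less_imp_le)
    show "(\<lambda>n. 1 / real (Suc (s n))) \<longlonglongrightarrow> 0"
      using LIMSEQ_subseq_LIMSEQ[OF LIMSEQ_Suc[OF lim_inverse_n'] s]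
      by (simp add: o_def)
  qed
  ultimately have g0: "?g 0 = 0" by (simp add: LIMSEQ_unique)
  \<comment> \<open>A nonconstant locally uniform limit of zero-free holomorphic functions is
    zero-free.\<close>
  have "?g 0 \<noteq> 0"
  proof (rule Hurwitz_no_zeros[of "ball 0 r" "\<lambda>n z. \<Sum>i\<in>A. u (s n) i * exp (l i * z)" ?g])
    show "uniform_limit K (\<lambda>n z. \<Sum>i\<in>A. u (s n) i * exp (l i * z)) ?g sequentially"
      if "compact K" for K
    proof -
      have "uniform_limit K (\<lambda>n z. u (s n) i * exp (l i * z)) (\<lambda>z. d i * exp (l i * z)) sequentially"
        if i: "i \<in> A" for i
      proof (rule uniform_lim_mult)
        show "uniform_limit K (\<lambda>n z. u (s n) i) (\<lambda>z. d i) sequentially"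
          using d[OF i] by (auto simp: uniform_limit_iff tendsto_iff)
        show "bounded ((\<lambda>z. exp (l i * z)) ` K)"
          by (intro compact_imp_bounded compact_continuous_image continuous_intros \<open>compact K\<close>)
        show "uniform_limit K (\<lambda>n z. exp (l i * z)) (\<lambda>z. exp (l i * z)) sequentially"
          by (rule uniform_limit_const)
        show "bounded ((\<lambda>z. d i) ` K)"
          by (rule bounded_subset[of "{d i}"]) auto
      qed
      with A show ?thesis by (rule uniform_limit_sum)
    qed
    \<comment> \<open>A constant limit would be identically 0 by \<open>g0\<close>; linear
      independence of the exponentials would then make every \<open>d i\<close> vanish, against
      \<open>norm_d\<close>.\<close>
    show "\<not> ?g constant_on ball 0 r"
    proof
      assume "?g constant_on ball 0 r"
      then obtain y where "?g z = y" if "z \<in> ball 0 r" for z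
        unfolding constant_on_def by blast
      then have "?g z = 0" if "z \<in> ball 0 r" for z
        using that g0 r by (metis centre_in_ball)
      then have "d i = 0" if "i \<in> A" for i
        using exp_sum_eq_0_imp_coeff_eq_0[OF A inj r _ that, of d] by blast
      then show False using norm_d by simp
    qed
    show "(\<lambda>z. \<Sum>i\<in>A. u (s n) i * exp (l i * z)) holomorphic_on ball 0 r" for n
      by (intro holomorphic_intros)
    show "?g holomorphic_on ball 0 r"
      by (intro holomorphic_intros)
    show "(\<Sum>i\<in>A. u (s n) i * exp (l i * z)) \<noteq> 0" if "z \<in> ball 0 r" for n z
      by (rule nz_u[OF that])
  qed (use r in auto)
  with g0 show False by simp
qed

subsection \<open>Lower bounds for Laurent polynomials\<close>

definition real_vec :: "int ^ 'n \<Rightarrow> real ^ 'n" where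
  "real_vec \<alpha> = (\<chi> j. real_of_int (\<alpha> $ j))"

lemma inj_real_vec: "inj real_vec"
  by (auto simp: inj_def real_vec_def vec_eq_iff)

lemma cpairing_cvec:
  "cpairing (cvec p q) (cvec x y) = Complex (p \<bullet> x - q \<bullet> y) (p \<bullet> y + q \<bullet> x)"
  by (simp add: cpairing_def cvec_def inner_vec_def complex_eq_iff sum_subtractf sum.distrib)

lemma norm_exp_cpairing_cvec: "norm (exp (cpairing (cvec p q) (cvec x y))) = exp (p \<bullet> x - q \<bullet> y)"
  by (simp add: cpairing_cvec)

lemma exp_cpairing_cvec_add:
  "exp (cpairing s (cvec (x + x') (y + y'))) = exp (cpairing s (cvec x y)) * exp (cpairing s (cvec x' y'))"
proof -
  have "cpairing s (cvec (x + x') (y + y')) = cpairing s (cvec x y) + cpairing s (cvec x' y')"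
    by (simp add: cpairing_def cvec_def sum.distrib[symmetric] complex_eq_iff algebra_simps)
  then show ?thesis by (simp add: exp_add)
qed

text \<open>Along a complex line with real direction \<open>u\<close>, the real part of the
  parameter moves \<open>x\<close> and the imaginary part moves \<open>\<theta>\<close>. The pairing
  is linear in the parameter, so a Laurent polynomial becomes an exponential sum there.\<close>

lemma cpairing_cvec_scaleR:
  "cpairing s (cvec (Re z *\<^sub>R u) (Im z *\<^sub>R u)) = cpairing s (cvec u 0) * z"
  by (simp add: cpairing_def cvec_def sum_distrib_left sum_distrib_right complex_eq_iff algebra_simps
      sum_subtractf sum.distrib)

lemma laurent_poly_exp_vec:
  "laurent_poly A a (exp_vec w) = (\<Sum>\<alpha>\<in>A. a \<alpha> * exp (cpairing (cvec (real_vec \<alpha>) 0) w))"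
  unfolding laurent_poly_def
proof (intro sum.cong refl arg_cong2[where f = "(*)"])
  fix \<alpha>
  have "Complex (of_int k) 0 = of_int k" for k by (simp add: complex_eq_iff)
  then show "(\<Prod>j\<in>UNIV. exp_vec w $ j powi \<alpha> $ j) = exp (cpairing (cvec (real_vec \<alpha>) 0) w)"
    by (simp add: exp_vec_def exp_power_int cpairing_def cvec_def real_vec_def exp_sum)
qed

lemma laurent_poly_nonzero:
  assumes "\<theta> \<notin> coamoeba f"
  shows "f (exp_vec (cvec x \<theta>)) \<noteq> 0"
proof
  assume "f (exp_vec (cvec x \<theta>)) = 0"
  then have "exp_vec (cvec x \<theta>) \<in> Arg_fiber \<theta> \<inter> torus_zeros f"
    by (simp add: Arg_fiber_def torus_zeros_def exp_vec_def)
  with assms show False by (auto simp: coamoeba_def)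
qed

text \<open>The directions to avoid form finitely many hyperplanes, hence a null set.\<close>

lemma separating_direction:
  fixes S :: "'a::euclidean_space set"
  assumes "finite S"
  obtains v where "inj_on (\<lambda>x. x \<bullet> v) S"
proof -
  let ?H = "(\<lambda>(x, y). {v. (x - y) \<bullet> v = 0}) ` (S \<times> S - Id)"
  have "negligible (\<Union> ?H)"
    using assms by (intro negligible_Union) (auto intro!: negligible_hyperplane)
  then have "\<Union> ?H \<noteq> UNIV" using non_negligible_UNIV by metis
  then obtain v where "v \<notin> \<Union> ?H" by auto
  then have "inj_on (\<lambda>x. x \<bullet> v) S"
    by (auto simp: inj_on_def inner_diff_left)
  then show thesis by (rule that)
qed

text \<open>On the complex line through \<open>x + i \<theta>\<close> with separating direction
  \<open>v\<close>, \<open>f\<close> is an exponential sum with the distinct frequencies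
  \<open>l \<alpha>\<close>. Only the coefficients \<open>b\<close> depend on \<open>x\<close> and
  \<open>\<theta>\<close>, so \<open>exp_sum_lower_bound\<close> supplies one constant for all of
  them.\<close>

lemma laurent_poly_lower_bound:
  fixes A :: "(int ^ 'n) set"
  assumes A: "finite A" and a: "\<And>\<alpha>. \<alpha> \<in> A \<Longrightarrow> a \<alpha> \<noteq> 0"
    and \<theta>0: "\<theta>0 \<notin> closure (coamoeba (laurent_poly A a))"
  obtains r c where "r > 0" "c > 0" "ball \<theta>0 r \<inter> closure (coamoeba (laurent_poly A a)) = {}"
    "\<And>\<theta> x \<alpha>. \<theta> \<in> ball \<theta>0 r \<Longrightarrow> \<alpha> \<in> A \<Longrightarrow>
       c * exp (real_vec \<alpha> \<bullet> x) \<le> norm (laurent_poly A a (exp_vec (cvec x \<theta>)))"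
proof -
  let ?f = "laurent_poly A a"
  have "open (- closure (coamoeba ?f))" by (simp add: open_Compl)
  with \<theta>0 obtain r where r: "r > 0" and "ball \<theta>0 r \<subseteq> - closure (coamoeba ?f)"
    by (meson ComplI open_contains_ball)
  then have disj: "ball \<theta>0 r \<inter> closure (coamoeba ?f) = {}" by auto
  obtain v where v: "inj_on (\<lambda>x. x \<bullet> v) (real_vec ` A)"
    using separating_direction[of "real_vec ` A"] A by auto
  define l where "l \<alpha> = complex_of_real (real_vec \<alpha> \<bullet> v)" for \<alpha>
  have l: "inj_on l A"
    using comp_inj_on[OF inj_on_subset[OF inj_real_vec subset_UNIV] v] 
    by (auto simp: inj_on_def l_def o_def)
  \<comment> \<open>A parameter below \<open>\<rho>\<close> in modulus moves the argument by less
    than \<open>r / 2\<close>. Adding 1 covers \<open>v = 0\<close>, which can occur when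
    \<open>A\<close> has at most one element.\<close>
  define \<rho> where "\<rho> = r / 2 / (norm v + 1)"
  have \<rho>: "\<rho> > 0" using r by (simp add: \<rho>_def add_nonneg_pos)
  from exp_sum_lower_bound[OF A l \<rho>] obtain c where c: "c > 0"
    and lower: "\<And>b. (\<And>z. z \<in> ball 0 \<rho> \<Longrightarrow> (\<Sum>i\<in>A. b i * exp (l i * z)) \<noteq> 0) \<Longrightarrow>
           c * (\<Sum>i\<in>A. norm (b i)) \<le> norm (\<Sum>i\<in>A. b i)" by blast
  \<comment> \<open>Inserting 1 keeps the minimum defined for empty \<open>A\<close>.\<close>
  define m where "m = Min (insert 1 ((norm \<circ> a) ` A))"
  have m: "m > 0" using A a by (auto simp: m_def)
  have m_le: "m \<le> norm (a \<alpha>)" if "\<alpha> \<in> A" for \<alpha>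
    using A that by (auto simp: m_def intro!: Min_le)
  show thesis
  proof (rule that[of "r / 2" "c * m"])
    show "ball \<theta>0 (r / 2) \<inter> closure (coamoeba ?f) = {}"
      using disj r by (auto simp: disjoint_iff)
    fix \<theta> x :: "real ^ 'n" and \<alpha>
    assume \<theta>: "\<theta> \<in> ball \<theta>0 (r / 2)" and \<alpha>: "\<alpha> \<in> A"
    define b where "b \<beta> = a \<beta> * exp (cpairing (cvec (real_vec \<beta>) 0) (cvec x \<theta>))" for \<beta>
    have norm_b: "norm (b \<beta>) = norm (a \<beta>) * exp (real_vec \<beta> \<bullet> x)" for \<beta>
      by (simp add: b_def norm_mult norm_exp_cpairing_cvec del: norm_exp_eq_Re)
    have "(\<Sum>\<beta>\<in>A. b \<beta> * exp (l \<beta> * z)) \<noteq> 0" if z: "z \<in> ball 0 \<rho>" for z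
    proof -
      have "norm (Im z *\<^sub>R v) \<le> norm z * (norm v + 1)"
        by (auto intro!: mult_mono abs_Im_le_cmod)
      also have "\<dots> < \<rho> * (norm v + 1)"
        using z by (intro mult_strict_right_mono) (auto simp: add_nonneg_pos)
      also have "\<rho> * (norm v + 1) = r / 2"
        using norm_ge_zero[of v] nonzero_eq_divide_eq[of "norm v + 1" \<rho> "r / 2"]
        by (simp only: \<rho>_def) linarith
      finally have "norm (Im z *\<^sub>R v) < r / 2" .
      then have "\<theta> + Im z *\<^sub>R v \<in> ball \<theta>0 r"
        using \<theta> norm_triangle_ineq4[of "\<theta>0 - \<theta>" "Im z *\<^sub>R v"] by (simp add: dist_norm algebra_simps)
      then have "\<theta> + Im z *\<^sub>R v \<notin> coamoeba ?f"
        using disj closure_subset by blast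
      from laurent_poly_nonzero[OF this, of "x + Re z *\<^sub>R v"]
      have "(\<Sum>\<beta>\<in>A. a \<beta> * (exp (cpairing (cvec (real_vec \<beta>) 0) (cvec x \<theta>)) *
              exp (cpairing (cvec (real_vec \<beta>) 0) (cvec v 0) * z))) \<noteq> 0"
        by (simp add: laurent_poly_exp_vec exp_cpairing_cvec_add cpairing_cvec_scaleR)
      moreover have "cpairing (cvec (real_vec \<beta>) 0) (cvec v 0) = l \<beta>" for \<beta>
        by (simp add: cpairing_cvec l_def complex_eq_iff)
      ultimately show ?thesis by (simp add: b_def mult_ac)
    qed
    from lower[of b, OF this] have "c * (\<Sum>\<beta>\<in>A. norm (b \<beta>)) \<le> norm (?f (exp_vec (cvec x \<theta>)))"
      by (simp add: b_def laurent_poly_exp_vec)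
    moreover have "m * exp (real_vec \<alpha> \<bullet> x) \<le> norm (b \<alpha>)"
      using m_le[OF \<alpha>] by (simp add: norm_b)
    moreover have "norm (b \<alpha>) \<le> (\<Sum>\<beta>\<in>A. norm (b \<beta>))"
      using A \<alpha> by (intro member_le_sum) auto
    ultimately show "c * m * exp (real_vec \<alpha> \<bullet> x) \<le> norm (?f (exp_vec (cvec x \<theta>)))"
      using c by (smt (verit, best) mult.assoc mult_left_mono)
  qed (use r c m in auto)
qed

text \<open>\<open>\<delta>\<close> is the radius of a closed ball around \<open>\<sigma>\<close>
  inside the hull. If the bound failed for \<open>x\<close>, the hull would lie in an open
  half-space whose boundary contains the point of that ball farthest in direction
  \<open>x\<close>.\<close>

lemma convex_hull_interior_linear_growth:
  fixes S :: "'a::euclidean_space set"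
  assumes "\<sigma> \<in> interior (convex hull S)"
  obtains \<delta> where "\<delta> > 0" "\<And>x. \<exists>p\<in>S. \<sigma> \<bullet> x + \<delta> * norm x \<le> p \<bullet> x"
proof -
  from assms obtain e where e: "e > 0" and sub: "cball \<sigma> e \<subseteq> convex hull S"
    by (meson mem_interior_cball)
  have "\<exists>p\<in>S. \<sigma> \<bullet> x + e * norm x \<le> p \<bullet> x" for x
  proof (rule ccontr)
    assume "\<not> ?thesis"
    then have "S \<subseteq> {y. x \<bullet> y < \<sigma> \<bullet> x + e * norm x}"
      by (auto simp: inner_commute not_le)
    then have *: "convex hull S \<subseteq> {y. x \<bullet> y < \<sigma> \<bullet> x + e * norm x}"
      by (rule hull_minimal) (rule convex_halfspace_lt)
    \<comment> \<open>For \<open>x = 0\<close> the quotient is 0 and the point is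
      \<open>\<sigma>\<close>; the half-space condition then reads \<open>0 < 0\<close>.\<close>
    have "\<sigma> + (e / norm x) *\<^sub>R x \<in> cball \<sigma> e" using e by (simp add: dist_norm)
    with sub * have "x \<bullet> (\<sigma> + (e / norm x) *\<^sub>R x) < \<sigma> \<bullet> x + e * norm x" by blast
    then show False
      by (cases "x = 0")
         (simp_all add: inner_add_right inner_commute power2_norm_eq_inner[symmetric] power2_eq_square)
  qed
  with e show thesis by (rule that)
qed

subsection \<open>Gaussian integrals and Fourier inversion\<close>

lemma
  fixes g :: "'a::euclidean_space \<Rightarrow> real \<Rightarrow> 'b::{real_normed_field, banach, second_countable_topology}"
  assumes g: "\<And>b. b \<in> Basis \<Longrightarrow> integrable lborel (g b)"
  shows integrable_lborel_prod_Basis: "integrable lborel (\<lambda>x. \<Prod>b\<in>Basis. g b (x \<bullet> b))"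
    and integral_lborel_prod_Basis:
      "(LINT x|lborel. (\<Prod>b\<in>Basis. g b (x \<bullet> b))) = (\<Prod>b\<in>Basis. integral\<^sup>L lborel (g b))"
proof -
  interpret product_sigma_finite "\<lambda>_::'a. lborel :: real measure" ..
  have [measurable]: "g b \<in> borel_measurable borel" if "b \<in> Basis" for b
    using borel_measurable_integrable[OF g[OF that]] by simp
  have [simp]: "(\<Prod>b\<in>Basis. g b ((\<Sum>c\<in>Basis. f c *\<^sub>R c) \<bullet> b)) = (\<Prod>b\<in>Basis. g b (f b))" for f
    by (intro prod.cong refl) (simp add: inner_sum_left inner_Basis if_distrib cong: if_cong)
  show "integrable lborel (\<lambda>x. \<Prod>b\<in>Basis. g b (x \<bullet> b))"
    by (subst lborel_eq) (simp add: integrable_distr_eq product_integrable_prod g)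
  show "(LINT x|lborel. (\<Prod>b\<in>Basis. g b (x \<bullet> b))) = (\<Prod>b\<in>Basis. integral\<^sup>L lborel (g b))"
    by (subst lborel_eq) (simp add: integral_distr product_integral_prod g)
qed

lemma integrable_exp_neg_abs:
  assumes "c > 0"
  shows "integrable lborel (\<lambda>x::real. exp (- c * \<bar>x\<bar>))"
proof (rule Bochner_Integration.integrable_bound)
  let ?h = "\<lambda>x. indicator {0<..} x *\<^sub>R exp (- (x * c))"
  have "integrable lborel ?h"
    using integrable_I0i_exp_mscale[OF assms] by (simp add: set_integrable_def)
  moreover from this have "integrable lborel (\<lambda>x. ?h (0 + (-1) * x))"
    by (rule lborel_integrable_real_affine) simp
  ultimately show "integrable lborel (\<lambda>x. ?h x + ?h (0 + (-1) * x))"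
    by (rule Bochner_Integration.integrable_add)
  \<comment> \<open>The two one-sided exponentials agree with the function except at 0, where both
    indicators vanish.\<close>
  show "AE x in lborel. norm (exp (- c * \<bar>x\<bar>)) \<le> norm (?h x + ?h (0 + (-1) * x))"
    using AE_lborel_singleton[of 0] by eventually_elim (auto simp: indicator_def mult.commute)
qed simp

lemma integrable_exp_neg_norm:
  assumes "c > 0"
  shows "integrable lborel (\<lambda>x::'a::euclidean_space. exp (- c * norm x))"
proof (rule Bochner_Integration.integrable_bound)
  \<comment> \<open>The sum of the absolute coordinates is at most \<open>DIM('a) * norm x\<close>,
    so this rate makes the product of one-dimensional exponentials a majorant.\<close>
  let ?d = "c / DIM('a)"
  have d: "?d > 0" using assms by simp
  show "integrable lborel (\<lambda>x::'a. \<Prod>b\<in>Basis. exp (- ?d * \<bar>x \<bullet> b\<bar>))"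
    by (rule integrable_lborel_prod_Basis) (rule integrable_exp_neg_abs[OF d])
  show "AE x in lborel. norm (exp (- c * norm x)) \<le> norm (\<Prod>b\<in>Basis. exp (- ?d * \<bar>(x::'a) \<bullet> b\<bar>))"
  proof (rule AE_I2)
    fix x :: 'a
    have "(\<Sum>b\<in>Basis. \<bar>x \<bullet> b\<bar>) \<le> DIM('a) * norm x"
      using sum_bounded_above[of Basis "\<lambda>b. \<bar>x \<bullet> b\<bar>" "norm x"] by (simp add: Basis_le_norm)
    then have "?d * (\<Sum>b\<in>Basis. \<bar>x \<bullet> b\<bar>) \<le> c * norm x"
      using assms by (simp add: field_simps)
    then show "norm (exp (- c * norm x)) \<le> norm (\<Prod>b\<in>Basis. exp (- ?d * \<bar>x \<bullet> b\<bar>))"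
      by (simp flip: exp_sum add: sum_negf sum_divide_distrib sum_distrib_left)
  qed
qed simp

text \<open>Up to the factor \<open>sqrt (2 * pi)\<close> this is the characteristic function of the
  standard normal distribution.\<close>

lemma
  shows integrable_gaussian_cis: "integrable lborel (\<lambda>x::real. of_real (exp (- x\<^sup>2 / 2)) * cis (t * x))"
    and integral_gaussian_cis:
      "(LINT x|lborel. of_real (exp (- x\<^sup>2 / 2)) * cis (t * x)) = of_real (sqrt (2 * pi) * exp (- t\<^sup>2 / 2))"
proof -
  have *: "of_real (exp (- x\<^sup>2 / 2)) * cis (t * x)
     = of_real (sqrt (2 * pi)) * (std_normal_density x *\<^sub>R cis (t * x))" for x
    by (simp add: std_normal_density_def scaleR_conv_of_real)
  have [measurable]: "(\<lambda>x. cis (t * x)) \<in> borel_measurable borel"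
    by (intro borel_measurable_continuous_onI continuous_intros)
  have "integrable lborel (\<lambda>x. std_normal_density x *\<^sub>R cis (t * x))"
    by (rule Bochner_Integration.integrable_bound[OF integrable_normal_density[of 1 0]]) auto
  then show "integrable lborel (\<lambda>x::real. of_real (exp (- x\<^sup>2 / 2)) * cis (t * x))"
    unfolding * by (rule integrable_mult_right)
  have "(LINT x|lborel. std_normal_density x *\<^sub>R cis (t * x)) = char std_normal_distribution t"
    by (simp add: char_def integral_density cis_conv_exp mult_ac)
  then show "(LINT x|lborel. of_real (exp (- x\<^sup>2 / 2)) * cis (t * x)) = of_real (sqrt (2 * pi) * exp (- t\<^sup>2 / 2))"
    unfolding * integral_mult_right_zero by (simp add: char_std_normal_distribution)
qed


text \<open>The Gaussian and the character both factor over the coordinates, which reduces the claim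
  to dimension one.\<close>

lemma
  fixes y :: "'a::euclidean_space"
  shows integrable_gaussian_cis_inner:
      "integrable lborel (\<lambda>x. of_real (exp (- (norm x)\<^sup>2 / 2)) * cis (x \<bullet> y))" (is ?A)
    and integral_gaussian_cis_inner:
      "(LINT x|lborel. of_real (exp (- (norm x)\<^sup>2 / 2)) * cis (x \<bullet> y))
        = of_real (sqrt (2 * pi) ^ DIM('a) * exp (- (norm y)\<^sup>2 / 2))" (is ?B)
proof -
  have norm_sq: "(norm x)\<^sup>2 = (\<Sum>b\<in>Basis. (x \<bullet> b)\<^sup>2)" for x :: 'a
    unfolding power2_norm_eq_inner by (subst euclidean_inner) (simp add: power2_eq_square)
  have exp_sq: "exp (- (norm x)\<^sup>2 / 2) = (\<Prod>b\<in>Basis. exp (- (x \<bullet> b)\<^sup>2 / 2))" for x :: 'a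
    by (simp add: norm_sq sum_negf sum_divide_distrib flip: exp_sum)
  have cis_inner: "cis (x \<bullet> y) = (\<Prod>b\<in>Basis. cis ((y \<bullet> b) * (x \<bullet> b)))" for x
    by (simp add: cis_conv_exp euclidean_inner[of x y] sum_distrib_left mult_ac flip: exp_sum)
  have *: "of_real (exp (- (norm x)\<^sup>2 / 2)) * cis (x \<bullet> y)
      = (\<Prod>b\<in>Basis. of_real (exp (- (x \<bullet> b)\<^sup>2 / 2)) * cis ((y \<bullet> b) * (x \<bullet> b)))" for x
    by (simp only: exp_sq cis_inner prod.distrib of_real_prod)
  show ?A unfolding *
    by (rule integrable_lborel_prod_Basis) (rule integrable_gaussian_cis)
  have "(LINT x|lborel. of_real (exp (- (norm x)\<^sup>2 / 2)) * cis (x \<bullet> y)) =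
     (\<Prod>b\<in>Basis. LINT t|lborel. of_real (exp (- t\<^sup>2 / 2)) * cis ((y \<bullet> b) * t))"
    unfolding * by (rule integral_lborel_prod_Basis) (rule integrable_gaussian_cis)
  then show ?B
    by (simp only: integral_gaussian_cis exp_sq of_real_mult prod.distrib of_real_prod) simp
qed

lemma integral_lborel_affine:
  fixes f :: "'a::euclidean_space \<Rightarrow> 'b::{banach, second_countable_topology}"
  assumes [measurable]: "f \<in> borel_measurable borel" and c: "c \<noteq> 0"
  shows "integral\<^sup>L lborel f = \<bar>c\<bar> ^ DIM('a) *\<^sub>R (LINT x|lborel. f (t + c *\<^sub>R x))"
  by (subst lborel_affine[OF c, of t]) (simp add: integral_density integral_distr)

lemma integrable_lborel_affine:
  fixes f :: "'a::euclidean_space \<Rightarrow> 'b::{banach, second_countable_topology}"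
  assumes f: "integrable lborel f" and c: "c \<noteq> 0"
  shows "integrable lborel (\<lambda>x. f (t + c *\<^sub>R x))"
proof -
  have [measurable]: "f \<in> borel_measurable borel" using borel_measurable_integrable[OF f] by simp
  have "integrable (density (distr lborel borel (\<lambda>x. t + c *\<^sub>R x)) (\<lambda>_. \<bar>c\<bar> ^ DIM('a))) f"
    using f by (subst (asm) lborel_affine[OF c, of t])
  then have "integrable lborel (\<lambda>x. \<bar>c\<bar> ^ DIM('a) *\<^sub>R f (t + c *\<^sub>R x))"
    by (simp add: integrable_density integrable_distr_eq)
  then have "integrable lborel (\<lambda>x. inverse (\<bar>c\<bar> ^ DIM('a)) *\<^sub>R \<bar>c\<bar> ^ DIM('a) *\<^sub>R f (t + c *\<^sub>R x))"
    by (rule integrable_scaleR_right)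
  then show ?thesis using c by simp
qed

text \<open>A Gaussian factor \<open>\<phi> (\<epsilon> k *\<^sub>R t)\<close> makes the double
  integral absolutely convergent. Exchanging the integrals turns it into an average of
  \<open>G\<close> around \<open>x0\<close> with Gaussian weights, and both sides converge as
  \<open>\<epsilon> k\<close> tends to 0.\<close>

lemma Fourier_inversion:
  fixes G :: "'a::euclidean_space \<Rightarrow> complex"
  assumes G: "integrable lborel G" and cont: "continuous_on UNIV G" and B: "\<And>x. norm (G x) \<le> B"
    and Gh: "integrable lborel (\<lambda>t. LINT x|lborel. G x * cis (t \<bullet> x))"
  shows "(LINT t|lborel. (LINT x|lborel. G x * cis (t \<bullet> x)) * cis (- (t \<bullet> x0)))
           = of_real ((2 * pi) ^ DIM('a)) * G x0"
proof -
  define \<phi> where "\<phi> x = complex_of_real (exp (- (norm (x::'a))\<^sup>2 / 2))" for x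
  define s where "s = complex_of_real (sqrt (2 * pi) ^ DIM('a))"
  define H where "H t = (LINT x|lborel. G x * cis (t \<bullet> x))" for t
  define \<epsilon> where "\<epsilon> k = 1 / real (Suc k)" for k
  have \<epsilon>: "\<epsilon> k > 0" for k by (simp add: \<epsilon>_def)
  have \<epsilon>0: "\<epsilon> \<longlonglongrightarrow> 0"
    unfolding \<epsilon>_def using LIMSEQ_Suc[OF lim_inverse_n'] by simp
  have [measurable]: "G \<in> borel_measurable borel" "H \<in> borel_measurable borel"
    using borel_measurable_integrable[OF G] borel_measurable_integrable[OF Gh] by (simp_all add: H_def[abs_def])
  have [measurable]: "\<phi> \<in> borel_measurable borel" 
    unfolding \<phi>_def by measurable
  have [measurable]: "cis \<in> borel_measurable borel"
    by (intro borel_measurable_continuous_onI continuous_intros)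
  have \<phi>_le: "norm (\<phi> x) \<le> 1" for x by (simp add: \<phi>_def)
  have \<phi>_int: "integrable lborel (\<lambda>x. \<phi> x * cis (x \<bullet> y))" for y
    unfolding \<phi>_def by (rule integrable_gaussian_cis_inner)
  have \<phi>_hat: "(LINT x|lborel. \<phi> x * cis (x \<bullet> y)) = s * \<phi> y" for y
    unfolding \<phi>_def s_def by (simp only: integral_gaussian_cis_inner of_real_mult)
  have \<phi>0: "integrable lborel \<phi>" "(LINT x|lborel. \<phi> x) = s"
    using \<phi>_int[of 0] \<phi>_hat[of 0] by (simp_all add: \<phi>_def[of 0])
  have \<phi>_cont: "isCont \<phi> x" for x
    unfolding \<phi>_def by (intro continuous_intros) simp_all
  have eq: "(LINT t|lborel. H t * cis (- (t \<bullet> x0)) * \<phi> (\<epsilon> k *\<^sub>R t))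
      = (LINT y|lborel. G (x0 + \<epsilon> k *\<^sub>R y) * (s * \<phi> y))" for k
  proof -
    let ?e = "\<epsilon> k"
    have \<phi>_scale: "integrable lborel (\<lambda>t. \<phi> (?e *\<^sub>R t))"
      using integrable_lborel_affine[OF \<phi>0(1), of ?e 0] \<epsilon>[of k] by simp
    have "integrable (lborel \<Otimes>\<^sub>M lborel) (\<lambda>(t, x). G x * cis (t \<bullet> (x - x0)) * \<phi> (?e *\<^sub>R t))"
    proof (rule lborel_pair.Fubini_integrable)
      have "(LINT x|lborel. norm (G x * cis (t \<bullet> (x - x0)) * \<phi> (?e *\<^sub>R t)))
          = (LINT x|lborel. norm (G x)) * norm (\<phi> (?e *\<^sub>R t))" for t
        by (simp add: norm_mult)
      then show "integrable lborel (\<lambda>t. LINT x|lborel. norm (case (t, x) of (t, x) \<Rightarrow>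
          G x * cis (t \<bullet> (x - x0)) * \<phi> (?e *\<^sub>R t)))"
        using \<phi>_scale by simp
      have "integrable lborel (\<lambda>x. G x * cis (t \<bullet> (x - x0)))" for t
        by (rule Bochner_Integration.integrable_bound[OF G]) (simp_all add: norm_mult)
      then show "AE t in lborel. integrable lborel (\<lambda>x. case (t, x) of (t, x) \<Rightarrow>
          G x * cis (t \<bullet> (x - x0)) * \<phi> (?e *\<^sub>R t))"
        by simp
    qed simp
    note fub = lborel_pair.Fubini_integral[OF this]
    \<comment> \<open>The Gaussian is its own transform up to \<open>s\<close>; rescaling by
      \<open>?e\<close> concentrates it at \<open>x0\<close>.\<close>
    have inner: "(LINT t|lborel. G x * cis (t \<bullet> (x - x0)) * \<phi> (?e *\<^sub>R t))
        = of_real (1 / ?e ^ DIM('a)) * (G x * (s * \<phi> ((1 / ?e) *\<^sub>R (x - x0))))" for x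
    proof -
      have "s * \<phi> ((1 / ?e) *\<^sub>R (x - x0))
          = ?e ^ DIM('a) *\<^sub>R (LINT t|lborel. \<phi> (?e *\<^sub>R t) * cis (t \<bullet> (x - x0)))"
        using \<epsilon>[of k] unfolding \<phi>_hat[symmetric]
        by (subst integral_lborel_affine[of _ ?e 0]) simp_all
      then have *: "(LINT t|lborel. \<phi> (?e *\<^sub>R t) * cis (t \<bullet> (x - x0)))
          = of_real (1 / ?e ^ DIM('a)) * (s * \<phi> ((1 / ?e) *\<^sub>R (x - x0)))"
        using \<epsilon>[of k] by (simp add: scaleR_conv_of_real)
      have "(LINT t|lborel. G x * cis (t \<bullet> (x - x0)) * \<phi> (?e *\<^sub>R t))
          = (LINT t|lborel. G x * (\<phi> (?e *\<^sub>R t) * cis (t \<bullet> (x - x0))))"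
        by (simp only: mult_ac)
      also have "\<dots> = G x * (LINT t|lborel. \<phi> (?e *\<^sub>R t) * cis (t \<bullet> (x - x0)))"
        by (rule integral_mult_right_zero)
      finally show ?thesis unfolding * by (simp only: mult_ac)
    qed
    have "(LINT t|lborel. H t * cis (- (t \<bullet> x0)) * \<phi> (?e *\<^sub>R t))
        = (LINT t|lborel. LINT x|lborel. G x * cis (t \<bullet> (x - x0)) * \<phi> (?e *\<^sub>R t))"
    proof (rule Bochner_Integration.integral_cong[OF refl])
      fix t
      have "H t * cis (- (t \<bullet> x0)) * \<phi> (?e *\<^sub>R t)
          = (LINT x|lborel. G x * cis (t \<bullet> x) * (cis (- (t \<bullet> x0)) * \<phi> (?e *\<^sub>R t)))"
        by (simp add: H_def)
      also have "\<dots> = (LINT x|lborel. G x * cis (t \<bullet> (x - x0)) * \<phi> (?e *\<^sub>R t))"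
        by (intro Bochner_Integration.integral_cong refl)
           (simp add: inner_diff_right mult_ac cis_mult)
      finally show "H t * cis (- (t \<bullet> x0)) * \<phi> (?e *\<^sub>R t)
          = (LINT x|lborel. G x * cis (t \<bullet> (x - x0)) * \<phi> (?e *\<^sub>R t))" .
    qed
    also have "\<dots> = (LINT x|lborel. of_real (1 / ?e ^ DIM('a)) * (G x * (s * \<phi> ((1 / ?e) *\<^sub>R (x - x0)))))"
      using fub inner by simp
    also have "\<dots> = (LINT y|lborel. G (x0 + ?e *\<^sub>R y) * (s * \<phi> y))"
      using \<epsilon>[of k] by (subst integral_lborel_affine[of _ ?e x0]) (simp_all add: scaleR_conv_of_real)
    finally show ?thesis .
  qed
  \<comment> \<open>On the transform side the Gaussian factor tends to 1 and the integrable
    \<open>norm (H t)\<close> dominates.\<close>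
  have "(\<lambda>k. LINT t|lborel. H t * cis (- (t \<bullet> x0)) * \<phi> (\<epsilon> k *\<^sub>R t))
      \<longlonglongrightarrow> (LINT t|lborel. H t * cis (- (t \<bullet> x0)))"
  proof (rule integral_dominated_convergence[where w = "\<lambda>t. norm (H t)"])
    show "integrable lborel (\<lambda>t. norm (H t))" using Gh by (simp add: H_def)
    have "(\<lambda>k. \<phi> (\<epsilon> k *\<^sub>R t)) \<longlonglongrightarrow> \<phi> (0 *\<^sub>R t)" for t
      by (intro isCont_tendsto_compose[OF \<phi>_cont] tendsto_intros \<epsilon>0)
    moreover have "\<phi> 0 = 1" by (simp add: \<phi>_def)
    ultimately have "(\<lambda>k. H t * cis (- (t \<bullet> x0)) * \<phi> (\<epsilon> k *\<^sub>R t)) \<longlonglongrightarrow> H t * cis (- (t \<bullet> x0)) * 1" for t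
      by (intro tendsto_mult_left) simp
    then show "AE t in lborel. (\<lambda>k. H t * cis (- (t \<bullet> x0)) * \<phi> (\<epsilon> k *\<^sub>R t)) \<longlonglongrightarrow> H t * cis (- (t \<bullet> x0))"
      by simp
    show "AE t in lborel. norm (H t * cis (- (t \<bullet> x0)) * \<phi> (\<epsilon> k *\<^sub>R t)) \<le> norm (H t)" for k
      using \<phi>_le by (intro AE_I2) (auto simp: norm_mult intro!: mult_left_le)
  qed auto
  \<comment> \<open>Here continuity of \<open>G\<close> gives the pointwise limit and its bound
    \<open>B\<close> the majorant.\<close>
  moreover have "(\<lambda>k. LINT y|lborel. G (x0 + \<epsilon> k *\<^sub>R y) * (s * \<phi> y))
      \<longlonglongrightarrow> (LINT y|lborel. G x0 * (s * \<phi> y))"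
  proof (rule integral_dominated_convergence[where w = "\<lambda>y. B * norm (s * \<phi> y)"])
    show "integrable lborel (\<lambda>y. B * norm (s * \<phi> y))" using \<phi>0 by simp
    have "isCont G x" for x using cont by (simp add: continuous_on_eq_continuous_at)
    then have "(\<lambda>k. G (x0 + \<epsilon> k *\<^sub>R y)) \<longlonglongrightarrow> G (x0 + 0 *\<^sub>R y)" for y
      by (intro isCont_tendsto_compose[of _ G] tendsto_intros \<epsilon>0)
    then show "AE y in lborel. (\<lambda>k. G (x0 + \<epsilon> k *\<^sub>R y) * (s * \<phi> y)) \<longlonglongrightarrow> G x0 * (s * \<phi> y)"
      by (intro AE_I2) (auto intro!: tendsto_eq_intros)
    show "AE y in lborel. norm (G (x0 + \<epsilon> k *\<^sub>R y) * (s * \<phi> y)) \<le> B * norm (s * \<phi> y)" for k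
      using B by (intro AE_I2) (auto simp: norm_mult intro!: mult_right_mono)
  qed auto
  ultimately have "(LINT t|lborel. H t * cis (- (t \<bullet> x0))) = (LINT y|lborel. G x0 * (s * \<phi> y))"
    unfolding eq by (rule LIMSEQ_unique)
  also have "\<dots> = (s * s) * G x0"
    using \<phi>0 by (simp add: mult_ac)
  \<comment> \<open>One factor \<open>s\<close> comes from the transform of \<open>\<phi>\<close>,
    the other from its integral.\<close>
  also have "s * s = of_real ((2 * pi) ^ DIM('a))"
    unfolding s_def of_real_mult[symmetric] power_mult_distrib[symmetric] by simp
  finally show ?thesis by (simp add: H_def)
qed

section \<open>Holomorphic dependence of integrals on a parameter\<close>

text \<open>A majorant of the function alone suffices: Cauchy's inequality on discs of fixed radius
  bounds the derivative by \<open>w x / \<rho>\<close>, and hence dominates the difference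
  quotients.\<close>

lemma holomorphic_on_lebesgue_integral:
  fixes F :: "complex \<Rightarrow> 'a \<Rightarrow> complex"
  assumes S: "open S"
    and hol: "\<And>x. x \<in> space M \<Longrightarrow> (\<lambda>z. F z x) holomorphic_on S"
    and meas: "\<And>z. z \<in> S \<Longrightarrow> F z \<in> borel_measurable M"
    and w: "integrable M w"
    and bound: "\<And>z x. z \<in> S \<Longrightarrow> x \<in> space M \<Longrightarrow> norm (F z x) \<le> w x"
  shows "(\<lambda>z. integral\<^sup>L M (F z)) holomorphic_on S"
  unfolding holomorphic_on_open[OF S]
proof
  fix z0 assume "z0 \<in> S"
  with S obtain r where "r > 0" and r: "cball z0 r \<subseteq> S"
    using open_contains_cball by blast
  \<comment> \<open>Half the radius leaves room for a closed disc of radius \<open>\<rho>\<close>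
    around every point of \<open>ball z0 \<rho>\<close>.\<close>
  define \<rho> where "\<rho> = r / 2"
  have \<rho>: "\<rho> > 0" using \<open>r > 0\<close> by (simp add: \<rho>_def)
  have sub: "cball z \<rho> \<subseteq> S" if "z \<in> ball z0 \<rho>" for z
  proof (rule order.trans[OF _ r], rule subsetI)
    fix y assume "y \<in> cball z \<rho>"
    with that show "y \<in> cball z0 r"
      using dist_triangle[of z0 y z] by (simp add: \<rho>_def)
  qed
  have sub': "ball z0 \<rho> \<subseteq> S" using sub[of z0] \<rho> ball_subset_cball[of z0 \<rho>] by auto
  define D where "D x = deriv (\<lambda>z. F z x) z0" for x
  have lip: "norm (F z x - F z0 x) \<le> w x / \<rho> * norm (z - z0)"
    if x: "x \<in> space M" and z: "z \<in> ball z0 \<rho>" for x z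
  proof (rule field_differentiable_bound[of "ball z0 \<rho>" "\<lambda>z. F z x" "deriv (\<lambda>z. F z x)"])
    fix y assume y: "y \<in> ball z0 \<rho>"
    have "((\<lambda>z. F z x) has_field_derivative deriv (\<lambda>z. F z x) y) (at y)"
      using hol[OF x] S sub' y by (intro holomorphic_derivI) auto
    then show "((\<lambda>z. F z x) has_field_derivative deriv (\<lambda>z. F z x) y) (at y within ball z0 \<rho>)"
      by (rule has_field_derivative_at_within)
    have hol_y: "(\<lambda>z. F z x) holomorphic_on cball y \<rho>"
      using hol[OF x] sub[OF y] by (rule holomorphic_on_subset)
    have "norm ((deriv ^^ 1) (\<lambda>z. F z x) y) \<le> fact 1 * w x / \<rho> ^ 1"
    proof (rule Cauchy_inequality)
      show "(\<lambda>z. F z x) holomorphic_on ball y \<rho>"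
        by (rule holomorphic_on_subset[OF hol_y]) auto
      show "norm (F z x) \<le> w x" if "norm (y - z) = \<rho>" for z
        using bound[OF _ x, of z] sub[OF y] that by (auto simp: dist_norm)
    qed (use \<rho> hol_y in \<open>auto intro: holomorphic_on_imp_continuous_on\<close>)
    then show "norm (deriv (\<lambda>z. F z x) y) \<le> w x / \<rho>" by simp
  qed (use z \<rho> in auto)
  have int: "integrable M (F z)" if "z \<in> S" for z
    using bound[OF that]
    by (intro Bochner_Integration.integrable_bound[OF w meas[OF that]] AE_I2)
       (auto intro: order.trans[OF _ abs_ge_self])
  \<comment> \<open>The limit is tested on sequences so that dominated convergence applies; this
    also makes \<open>D\<close> measurable, as a pointwise limit of difference quotients.\<close>
  have "((\<lambda>z. (integral\<^sup>L M (F z) - integral\<^sup>L M (F z0)) / (z - z0)) \<longlongrightarrow> integral\<^sup>L M D)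
          (at z0 within ball z0 \<rho>)"
    unfolding tendsto_at_iff_sequentially
  proof (intro allI impI)
    fix X :: "nat \<Rightarrow> complex"
    assume X: "\<forall>i. X i \<in> ball z0 \<rho> - {z0}" and lim: "X \<longlonglongrightarrow> z0"
    then have XS: "X i \<in> S" "X i \<noteq> z0" "X i \<in> ball z0 \<rho>" for i using sub' by auto
    let ?q = "\<lambda>i x. (F (X i) x - F z0 x) / (X i - z0)"
    have q_meas: "?q i \<in> borel_measurable M" for i
      using meas[OF XS(1)[of i]] meas[OF \<open>z0 \<in> S\<close>] by simp
    have q_lim: "(\<lambda>i. ?q i x) \<longlonglongrightarrow> D x" if x: "x \<in> space M" for x
    proof -
      have "((\<lambda>z. F z x) has_field_derivative D x) (at z0)"
        unfolding D_def by (rule holomorphic_derivI[OF hol[OF x] S \<open>z0 \<in> S\<close>])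
      then have "((\<lambda>z. (F z x - F z0 x) / (z - z0)) \<longlongrightarrow> D x) (at z0)"
        by (simp add: has_field_derivative_iff)
      then show ?thesis
        using X lim by (auto simp: tendsto_at_iff_sequentially o_def)
    qed
    have "(\<lambda>i. integral\<^sup>L M (?q i)) \<longlonglongrightarrow> integral\<^sup>L M D"
    proof (rule integral_dominated_convergence[where w = "\<lambda>x. w x / \<rho>"])
      show "D \<in> borel_measurable M"
        using q_meas q_lim by (rule borel_measurable_LIMSEQ_metric)
      show "AE x in M. norm (?q i x) \<le> w x / \<rho>" for i
        using lip[OF _ XS(3)[of i]] XS(2)[of i]
        by (intro AE_I2) (simp add: norm_divide pos_divide_le_eq)
    qed (use q_meas q_lim w in auto)
    then show "((\<lambda>z. (integral\<^sup>L M (F z) - integral\<^sup>L M (F z0)) / (z - z0)) \<circ> X) \<longlonglongrightarrow> integral\<^sup>L M D"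
      using int XS(1) \<open>z0 \<in> S\<close> by (simp add: o_def)
  qed
  then have "((\<lambda>z. integral\<^sup>L M (F z)) has_field_derivative integral\<^sup>L M D) (at z0)"
    using \<rho> by (simp add: has_field_derivative_iff at_within_open[of z0 "ball z0 \<rho>"])
  then show "\<exists>f'. ((\<lambda>z. integral\<^sup>L M (F z)) has_field_derivative f') (at z0)" ..
qed

subsection \<open>The Mellin transform\<close>

lemma continuous_on_cpairing_cvec [continuous_intros]:
  "continuous_on S (\<lambda>x. cpairing s (cvec x \<theta>))"
  unfolding cpairing_def cvec_def Complex_eq
  by (auto intro!: continuous_intros)

lemma branch_power_exp_vec:
  "branch_power \<theta> (exp_vec (cvec x \<theta>)) s = exp (cpairing s (cvec x \<theta>))"
  by (simp add: branch_power_def exp_vec_def cvec_def)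

text \<open>Each coordinate of the parametrisation depends on one variable only, so the Jacobian
  matrix is diagonal. Its determinant cancels the denominator of \<open>dz/z\<close> in
  \<open>mellin_form\<close>.\<close>

lemma form_pullback_exp_vec:
  "form_pullback (\<lambda>x. exp_vec (cvec x \<theta>)) g x
     = g (exp_vec (cvec x \<theta>)) * (\<Prod>j\<in>UNIV. exp_vec (cvec x \<theta>) $ j)"
proof -
  have D: "vector_derivative (\<lambda>h. exp_vec (cvec (x + h *\<^sub>R axis k 1) \<theta>) $ j) (at 0)
      = (if j = k then exp_vec (cvec x \<theta>) $ j else 0)" for j k
  proof (rule vector_derivative_at)
    have "(\<lambda>h. exp_vec (cvec (x + h *\<^sub>R axis k 1) \<theta>) $ j)
        = (\<lambda>h. exp_vec (cvec x \<theta>) $ j * exp (of_real h * of_real (axis k 1 $ j)))"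
      by (auto simp: exp_vec_def cvec_def fun_eq_iff complex_eq_iff Complex_eq exp_add[symmetric]
          algebra_simps)
    moreover have "((\<lambda>h. exp_vec (cvec x \<theta>) $ j * exp (of_real h * of_real (axis k 1 $ j)))
        has_vector_derivative (if j = k then exp_vec (cvec x \<theta>) $ j else 0)) (at 0)"
      by (rule has_vector_derivative_real_field)
         (auto intro!: derivative_eq_intros simp: axis_def)
    ultimately show "((\<lambda>h. exp_vec (cvec (x + h *\<^sub>R axis k 1) \<theta>) $ j)
        has_vector_derivative (if j = k then exp_vec (cvec x \<theta>) $ j else 0)) (at 0)"
      by simp
  qed
  show ?thesis by (simp add: form_pullback_def D det_diagonal)
qed

text \<open>The Jacobian matrix is \<open>\<i>\<close> times the identity, the source of the factor
  in \<open>ds = i^n dt\<close>.\<close>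

lemma form_pullback_cvec:
  fixes \<sigma> t :: "real ^ 'n"
  shows "form_pullback (\<lambda>t. cvec \<sigma> t) g t = g (cvec \<sigma> t) * \<i> ^ CARD('n)"
proof -
  have D: "vector_derivative (\<lambda>h. cvec \<sigma> (t + h *\<^sub>R axis k 1) $ j) (at 0) = (if j = k then \<i> else 0)"
    for j k
  proof (rule vector_derivative_at)
    have "(\<lambda>h. cvec \<sigma> (t + h *\<^sub>R axis k 1) $ j)
        = (\<lambda>h. cvec \<sigma> t $ j + \<i> * (of_real h * of_real (axis k 1 $ j)))"
      by (auto simp: cvec_def complex_eq_iff)
    moreover have "((\<lambda>h. cvec \<sigma> t $ j + \<i> * (of_real h * of_real (axis k 1 $ j)))
        has_vector_derivative (if j = k then \<i> else 0)) (at 0)"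
      by (rule has_vector_derivative_real_field)
         (auto intro!: derivative_eq_intros simp: axis_def)
    ultimately show "((\<lambda>h. cvec \<sigma> (t + h *\<^sub>R axis k 1) $ j)
        has_vector_derivative (if j = k then \<i> else 0)) (at 0)"
      by simp
  qed
  show ?thesis by (simp add: form_pullback_def D det_diagonal)
qed

lemma form_pullback_mellin_form:
  "form_pullback (\<lambda>x. exp_vec (cvec x \<theta>)) (mellin_form f \<theta> s)
     = (\<lambda>x. exp (cpairing s (cvec x \<theta>)) / f (exp_vec (cvec x \<theta>)))"
  by (auto simp: fun_eq_iff form_pullback_exp_vec mellin_form_def branch_power_exp_vec)
     (simp add: exp_vec_def)

section \<open>Decay of the Mellin integrand and independence of the argument\<close>

locale laurent_polynomial =
  fixes A :: "(int ^ 'n) set" and a :: "int ^ 'n \<Rightarrow> complex"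
  assumes finite_A: "finite A" and coeff_nonzero: "\<alpha> \<in> A \<Longrightarrow> a \<alpha> \<noteq> 0"
begin

abbreviation "f \<equiv> laurent_poly A a"

definition mellin_integrand :: "complex ^ 'n \<Rightarrow> real ^ 'n \<Rightarrow> real ^ 'n \<Rightarrow> complex" where
  "mellin_integrand s \<theta> x = exp (cpairing s (cvec x \<theta>)) / f (exp_vec (cvec x \<theta>))"

text \<open>The Mellin transform without the factor \<open>1 / (2 * pi * \<i>) ^ n\<close>;
  \<open>\<theta>\<close> stays an argument until independence of it is proved.\<close>

definition mellin_integral :: "complex ^ 'n \<Rightarrow> real ^ 'n \<Rightarrow> complex" where
  "mellin_integral s \<theta> = integral\<^sup>L lborel (mellin_integrand s \<theta>)"

lemma measurable_mellin_integrand [measurable]: "mellin_integrand s \<theta> \<in> borel_measurable borel"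
  unfolding mellin_integrand_def[abs_def] laurent_poly_exp_vec
  by (intro borel_measurable_divide borel_measurable_continuous_onI continuous_intros)

lemma continuous_mellin_integrand:
  "\<theta> \<notin> coamoeba f \<Longrightarrow> continuous_on UNIV (mellin_integrand s \<theta>)"
  using laurent_poly_nonzero[of \<theta> f]
  unfolding mellin_integrand_def[abs_def] laurent_poly_exp_vec
  by (intro continuous_intros) auto

text \<open>For each \<open>x\<close> some exponent in \<open>A\<close> exceeds
  \<open>\<sigma>\<close> in direction \<open>x\<close> by at least
  \<open>\<delta> * norm x\<close>, and the lower bound for that exponent makes the denominator win.
  None of \<open>r\<close>, \<open>C\<close>, \<open>\<delta>\<close> depends on
  \<open>t\<close>.\<close>

lemma mellin_integrand_decay:
  assumes \<sigma>: "\<sigma> \<in> interior (newton_polytope A)" and \<theta>0: "\<theta>0 \<notin> closure (coamoeba f)"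
  obtains r C \<delta> where "r > 0" "C > 0" "\<delta> > 0" "ball \<theta>0 r \<inter> closure (coamoeba f) = {}"
    "\<And>\<theta> t x. \<theta> \<in> ball \<theta>0 r \<Longrightarrow>
       norm (mellin_integrand (cvec \<sigma> t) \<theta> x) \<le> C * exp (- (t \<bullet> \<theta>)) * exp (- \<delta> * norm x)"
proof -
  from laurent_poly_lower_bound[OF finite_A coeff_nonzero \<theta>0] obtain r c
    where r: "r > 0" and c: "c > 0" and disj: "ball \<theta>0 r \<inter> closure (coamoeba f) = {}"
      and lower: "\<And>\<theta> x \<alpha>. \<theta> \<in> ball \<theta>0 r \<Longrightarrow> \<alpha> \<in> A \<Longrightarrow>
        c * exp (real_vec \<alpha> \<bullet> x) \<le> norm (f (exp_vec (cvec x \<theta>)))" by metis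
  have "newton_polytope A = convex hull (real_vec ` A)"
    by (simp add: newton_polytope_def real_vec_def[abs_def])
  with convex_hull_interior_linear_growth[of \<sigma> "real_vec ` A"] \<sigma> obtain \<delta>
    where \<delta>: "\<delta> > 0" and growth: "\<And>x. \<exists>p\<in>real_vec ` A. \<sigma> \<bullet> x + \<delta> * norm x \<le> p \<bullet> x"
    by metis
  show thesis
  proof (rule that[OF r _ \<delta> disj])
    show "1 / c > 0" using c by simp
    fix \<theta> t x assume \<theta>: "\<theta> \<in> ball \<theta>0 r"
    obtain \<alpha> where \<alpha>: "\<alpha> \<in> A" "\<sigma> \<bullet> x + \<delta> * norm x \<le> real_vec \<alpha> \<bullet> x" using growth[of x] by auto
    have "c * exp (\<sigma> \<bullet> x + \<delta> * norm x) \<le> c * exp (real_vec \<alpha> \<bullet> x)"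
      using \<alpha>(2) c by simp
    also have "\<dots> \<le> norm (f (exp_vec (cvec x \<theta>)))" by (rule lower[OF \<theta> \<alpha>(1)])
    finally have le: "c * exp (\<sigma> \<bullet> x + \<delta> * norm x) \<le> norm (f (exp_vec (cvec x \<theta>)))" .
    moreover have pos: "0 < c * exp (\<sigma> \<bullet> x + \<delta> * norm x)" using c by simp
    ultimately have "0 < norm (f (exp_vec (cvec x \<theta>)))" by linarith
    with le pos have "norm (mellin_integrand (cvec \<sigma> t) \<theta> x)
        \<le> exp (\<sigma> \<bullet> x - t \<bullet> \<theta>) / (c * exp (\<sigma> \<bullet> x + \<delta> * norm x))"
      unfolding mellin_integrand_def norm_divide norm_exp_cpairing_cvec
      using c by (intro divide_left_mono mult_pos_pos) simp_all
    also have "\<dots> = 1 / c * exp (- (t \<bullet> \<theta>)) * exp (- \<delta> * norm x)"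
      by (simp add: exp_diff exp_add exp_minus field_simps)
    finally show "norm (mellin_integrand (cvec \<sigma> t) \<theta> x)
        \<le> 1 / c * exp (- (t \<bullet> \<theta>)) * exp (- \<delta> * norm x)" .
  qed
qed

lemma integrable_mellin_integrand:
  assumes "\<sigma> \<in> interior (newton_polytope A)" "\<theta> \<notin> closure (coamoeba f)"
  shows "integrable lborel (mellin_integrand (cvec \<sigma> t) \<theta>)"
proof -
  from mellin_integrand_decay[OF assms] obtain r C \<delta> where "r > 0" and \<delta>: "\<delta> > 0"
    and bound: "\<And>\<theta>' t x. \<theta>' \<in> ball \<theta> r \<Longrightarrow>
       norm (mellin_integrand (cvec \<sigma> t) \<theta>' x) \<le> C * exp (- (t \<bullet> \<theta>')) * exp (- \<delta> * norm x)"
    by metis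
  show ?thesis
  proof (rule Bochner_Integration.integrable_bound)
    show "integrable lborel (\<lambda>x. C * exp (- (t \<bullet> \<theta>)) * exp (- \<delta> * norm x))"
      using integrable_exp_neg_norm[OF \<delta>] by (rule integrable_mult_right)
    show "AE x in lborel. norm (mellin_integrand (cvec \<sigma> t) \<theta> x)
        \<le> norm (C * exp (- (t \<bullet> \<theta>)) * exp (- \<delta> * norm x))"
      using bound[of \<theta>] \<open>r > 0\<close> by (intro AE_I2) (auto intro: order.trans[OF _ abs_ge_self])
  qed simp
qed

text \<open>In a direction \<open>u\<close> the integral of the integrand at \<open>x + i \<theta> + z u\<close> depends holomorphically on
  the complex number \<open>z\<close>. It does not change when \<open>z\<close> runs through the reals, by translation
  invariance, hence it is constant, and imaginary \<open>z\<close> give the other values of \<open>\<theta>\<close>.\<close>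

lemma mellin_integral_locally_constant:
  assumes \<sigma>: "\<sigma> \<in> interior (newton_polytope A)" and \<theta>0: "\<theta>0 \<notin> closure (coamoeba f)"
  obtains r where "r > 0"
    "\<And>\<theta> t. \<theta> \<in> ball \<theta>0 r \<Longrightarrow> mellin_integral (cvec \<sigma> t) \<theta> = mellin_integral (cvec \<sigma> t) \<theta>0"
proof -
  from mellin_integrand_decay[OF \<sigma> \<theta>0] obtain r C \<delta> where r: "r > 0" and C: "C > 0" and \<delta>: "\<delta> > 0"
    and disj: "ball \<theta>0 r \<inter> closure (coamoeba f) = {}"
    and bound: "\<And>\<theta> t x. \<theta> \<in> ball \<theta>0 r \<Longrightarrow>
       norm (mellin_integrand (cvec \<sigma> t) \<theta> x) \<le> C * exp (- (t \<bullet> \<theta>)) * exp (- \<delta> * norm x)"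
    by metis
  show thesis
  proof (rule that[OF r])
    fix \<theta> t :: "real ^ 'n"
    assume \<theta>: "\<theta> \<in> ball \<theta>0 r"
    let ?s = "cvec \<sigma> t"
    define u where "u = \<theta> - \<theta>0"
    show "mellin_integral ?s \<theta> = mellin_integral ?s \<theta>0"
    proof (cases "u = 0")
      case False
      \<comment> \<open>The disc of radius \<open>R\<close> contains \<open>\<i>\<close>, where the
        argument is \<open>\<theta>0 + u = \<theta>\<close>, and its points keep the argument in
        \<open>ball \<theta>0 r\<close>.\<close>
      define R where "R = r / norm u"
      have R: "R > 1" "R > 0"
        using False \<theta> r by (auto simp: R_def u_def dist_norm norm_minus_commute)
      define F where "F z x = mellin_integrand ?s (\<theta>0 + Im z *\<^sub>R u) (x + Re z *\<^sub>R u)" for z x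
      have small: "norm (Re z *\<^sub>R u) < r" "norm (Im z *\<^sub>R u) < r" if "z \<in> ball 0 R" for z
      proof -
        have "norm z * norm u < r" using that False by (simp add: R_def pos_less_divide_eq)
        then show "norm (Re z *\<^sub>R u) < r" "norm (Im z *\<^sub>R u) < r"
          using mult_right_mono[OF abs_Re_le_cmod[of z] norm_ge_zero[of u]]
            mult_right_mono[OF abs_Im_le_cmod[of z] norm_ge_zero[of u]] by auto
      qed
      have in_ball: "\<theta>0 + Im z *\<^sub>R u \<in> ball \<theta>0 r" if "z \<in> ball 0 R" for z
        using small(2)[OF that] by (simp add: dist_norm)
      have "(\<lambda>z. integral\<^sup>L lborel (F z)) holomorphic_on ball 0 R"
      proof (rule holomorphic_on_lebesgue_integral)
        fix x
        \<comment> \<open>Although \<open>F\<close> is written with real and imaginary parts, it is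
          a quotient of exponential sums in \<open>z\<close>.\<close>
        have "exp (cpairing s (cvec (x + Re z *\<^sub>R u) (\<theta>0 + Im z *\<^sub>R u)))
            = exp (cpairing s (cvec x \<theta>0)) * exp (cpairing s (cvec u 0) * z)" for s and z :: complex
          by (simp add: exp_cpairing_cvec_add cpairing_cvec_scaleR)
        then have F_eq: "F z x = exp (cpairing ?s (cvec x \<theta>0)) * exp (cpairing ?s (cvec u 0) * z) /
            (\<Sum>\<alpha>\<in>A. a \<alpha> * (exp (cpairing (cvec (real_vec \<alpha>) 0) (cvec x \<theta>0)) *
                exp (cpairing (cvec (real_vec \<alpha>) 0) (cvec u 0) * z)))"
          and f_eq: "f (exp_vec (cvec (x + Re z *\<^sub>R u) (\<theta>0 + Im z *\<^sub>R u))) =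
            (\<Sum>\<alpha>\<in>A. a \<alpha> * (exp (cpairing (cvec (real_vec \<alpha>) 0) (cvec x \<theta>0)) *
                exp (cpairing (cvec (real_vec \<alpha>) 0) (cvec u 0) * z)))" for z
          by (simp_all add: F_def mellin_integrand_def laurent_poly_exp_vec)
        have nz: "f (exp_vec (cvec (x + Re z *\<^sub>R u) (\<theta>0 + Im z *\<^sub>R u))) \<noteq> 0" if "z \<in> ball 0 R" for z
          using disj in_ball[OF that] closure_subset[of "coamoeba f"]
          by (intro laurent_poly_nonzero) blast
        show "(\<lambda>z. F z x) holomorphic_on ball 0 R"
          unfolding F_eq using nz unfolding f_eq by (intro holomorphic_intros) auto
        fix z :: complex assume z: "z \<in> ball 0 R"
        \<comment> \<open>Both shifts are shorter than \<open>r\<close>, so they cost only constant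
          factors and leave a majorant free of \<open>z\<close>.\<close>
        let ?th = "\<theta>0 + Im z *\<^sub>R u" and ?x = "x + Re z *\<^sub>R u"
        have "- (t \<bullet> ?th) \<le> norm t * norm ?th"
          using Cauchy_Schwarz_ineq2[of t ?th] by simp
        also have "\<dots> \<le> norm t * (norm \<theta>0 + r)"
          using norm_triangle_ineq[of \<theta>0 "Im z *\<^sub>R u"] small(2)[OF z] by (intro mult_left_mono) auto
        finally have 1: "exp (- (t \<bullet> ?th)) \<le> exp (norm t * (norm \<theta>0 + r))" by simp
        have "norm x - r \<le> norm ?x"
          using norm_triangle_ineq4[of ?x "Re z *\<^sub>R u"] small(1)[OF z] by simp
        then have "\<delta> * (norm x - r) \<le> \<delta> * norm ?x" using \<delta> by simp
        then have 2: "exp (- \<delta> * norm ?x) \<le> exp (\<delta> * r) * exp (- \<delta> * norm x)"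
          by (simp add: algebra_simps flip: exp_add)
        have "norm (F z x) \<le> C * exp (- (t \<bullet> ?th)) * exp (- \<delta> * norm ?x)"
          unfolding F_def by (rule bound[OF in_ball[OF z]])
        also have "\<dots> \<le> C * exp (norm t * (norm \<theta>0 + r)) * (exp (\<delta> * r) * exp (- \<delta> * norm x))"
          using 1 2 C by (intro mult_mono) auto
        finally show "norm (F z x)
            \<le> C * exp (norm t * (norm \<theta>0 + r)) * (exp (\<delta> * r) * exp (- \<delta> * norm x))" .
      next
        show "integrable lborel (\<lambda>x. C * exp (norm t * (norm \<theta>0 + r)) * (exp (\<delta> * r) * exp (- \<delta> * norm x)))"
          using integrable_exp_neg_norm[OF \<delta>] by (intro integrable_mult_right)
        show "F z \<in> borel_measurable lborel" for z
          unfolding F_def[abs_def] by simp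
      qed simp
      then have hol: "(\<lambda>z. integral\<^sup>L lborel (F z) - mellin_integral ?s \<theta>0) holomorphic_on ball 0 R"
        by (intro holomorphic_intros)
      have real: "integral\<^sup>L lborel (F z) - mellin_integral ?s \<theta>0 = 0" if "Im z = 0" for z
        using integral_lborel_affine[of "mellin_integrand ?s \<theta>0" 1 "Re z *\<^sub>R u"] that
        by (simp add: F_def[abs_def] mellin_integral_def add.commute)
      \<comment> \<open>The real points of the disc accumulate at 0, so the identity theorem carries
        the vanishing over to \<open>\<i>\<close>.\<close>
      have "0 islimpt {z \<in> ball 0 R. Im z = 0}"
        unfolding islimpt_approachable
      proof (intro allI impI)
        fix e :: real assume "e > 0"
        then show "\<exists>z'\<in>{z \<in> ball 0 R. Im z = 0}. z' \<noteq> 0 \<and> dist z' 0 < e"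
          using R by (intro bexI[of _ "of_real (min e R / 2)"]) auto
      qed
      then have "integral\<^sup>L lborel (F \<i>) - mellin_integral ?s \<theta>0 = 0"
        using R real
        by (intro analytic_continuation[OF hol, of "{z \<in> ball 0 R. Im z = 0}" 0 \<i>]) auto
      then show ?thesis
        by (simp add: F_def[abs_def] u_def mellin_integral_def)
    qed (simp add: u_def)
  qed
qed

lemma mellin_integral_constant_on_component:
  assumes \<sigma>: "\<sigma> \<in> interior (newton_polytope A)"
    and E: "E \<in> components (- closure (coamoeba f))" and "\<theta> \<in> E" "\<theta>' \<in> E"
  shows "mellin_integral (cvec \<sigma> t) \<theta> = mellin_integral (cvec \<sigma> t) \<theta>'"
proof -
  have "mellin_integral (cvec \<sigma> t) constant_on E"
  proof (rule locally_constant_imp_constant)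
    show "connected E" using E by (rule in_components_connected)
    fix \<theta>0 assume \<theta>0: "\<theta>0 \<in> E"
    then have "\<theta>0 \<notin> closure (coamoeba f)" using in_components_subset[OF E] by auto
    from mellin_integral_locally_constant[OF \<sigma> this] obtain r where r: "r > 0"
      and const: "\<And>\<theta> t. \<theta> \<in> ball \<theta>0 r \<Longrightarrow>
        mellin_integral (cvec \<sigma> t) \<theta> = mellin_integral (cvec \<sigma> t) \<theta>0" by blast
    show "\<exists>T. openin (top_of_set E) T \<and> \<theta>0 \<in> T \<and>
        (\<forall>x\<in>T. mellin_integral (cvec \<sigma> t) x = mellin_integral (cvec \<sigma> t) \<theta>0)"
    proof (intro exI conjI ballI)
      show "openin (top_of_set E) (E \<inter> ball \<theta>0 r)" by (rule openin_open_Int) simp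
      show "\<theta>0 \<in> E \<inter> ball \<theta>0 r" using \<theta>0 r by simp
      show "mellin_integral (cvec \<sigma> t) \<theta> = mellin_integral (cvec \<sigma> t) \<theta>0"
        if "\<theta> \<in> E \<inter> ball \<theta>0 r" for \<theta>
        using that by (intro const) simp
    qed
  qed
  then obtain y where y: "\<And>\<theta>. \<theta> \<in> E \<Longrightarrow> mellin_integral (cvec \<sigma> t) \<theta> = y"
    unfolding constant_on_def by blast
  then show ?thesis using assms(3,4) by simp
qed

section \<open>Decay in the imaginary part of \<open>s\<close> and inversion\<close>

text \<open>Estimating at \<open>\<theta>\<close> itself yields only the factor
  \<open>exp (- (t \<bullet> \<theta>))\<close>. Since the integral is locally constant in the
  argument, it may be estimated at a nearby point chosen for each \<open>t\<close>.\<close>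

lemma mellin_integral_decay:
  assumes \<sigma>: "\<sigma> \<in> interior (newton_polytope A)" and \<theta>: "\<theta> \<notin> closure (coamoeba f)"
  obtains K \<rho> where "\<rho> > 0"
    "\<And>t. norm (mellin_integral (cvec \<sigma> t) \<theta>) \<le> K * exp (- (t \<bullet> \<theta>)) * exp (- \<rho> * norm t)"
proof -
  from mellin_integrand_decay[OF \<sigma> \<theta>] obtain r C \<delta> where r: "r > 0" and \<delta>: "\<delta> > 0"
    and disj: "ball \<theta> r \<inter> closure (coamoeba f) = {}"
    and bound: "\<And>\<theta>' t x. \<theta>' \<in> ball \<theta> r \<Longrightarrow>
       norm (mellin_integrand (cvec \<sigma> t) \<theta>' x) \<le> C * exp (- (t \<bullet> \<theta>')) * exp (- \<delta> * norm x)"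
    by metis
  from mellin_integral_locally_constant[OF \<sigma> \<theta>] obtain r' where r': "r' > 0"
    and const: "\<And>\<theta>' t. \<theta>' \<in> ball \<theta> r' \<Longrightarrow> mellin_integral (cvec \<sigma> t) \<theta>' = mellin_integral (cvec \<sigma> t) \<theta>"
    by metis
  \<comment> \<open>A shift of length at most \<open>\<rho>\<close> stays in the ball where the
    bound holds and in the one where the integral is constant.\<close>
  define \<rho> where "\<rho> = min r r' / 2"
  have \<rho>: "\<rho> > 0" "\<rho> < r" "\<rho> < r'" using r r' by (auto simp: \<rho>_def)
  let ?J = "LINT x|lborel. exp (- \<delta> * norm (x :: real ^ 'n))"
  show thesis
  proof (rule that[OF \<rho>(1)])
    fix t
    \<comment> \<open>the shift of the fibre against \<open>t\<close> produces the decay\<close>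
    define \<theta>' where "\<theta>' = \<theta> + (\<rho> / norm t) *\<^sub>R t"
    have "norm ((\<rho> / norm t) *\<^sub>R t) \<le> \<rho>" using \<rho> by simp
    then have \<theta>': "\<theta>' \<in> ball \<theta> r" "\<theta>' \<in> ball \<theta> r'" using \<rho> by (auto simp: \<theta>'_def dist_norm)
    \<comment> \<open>For \<open>t = 0\<close> the quotient in \<open>\<theta>'\<close> is 0, so
      there is no shift.\<close>
    have t\<theta>': "t \<bullet> \<theta>' = t \<bullet> \<theta> + \<rho> * norm t"
      by (cases "t = 0")
         (simp_all add: \<theta>'_def inner_add_right power2_norm_eq_inner[symmetric] power2_eq_square)
    have "norm (mellin_integral (cvec \<sigma> t) \<theta>) = norm (mellin_integral (cvec \<sigma> t) \<theta>')"
      using const[OF \<theta>'(2)] by simp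
    also have "\<dots> \<le> (LINT x|lborel. C * exp (- (t \<bullet> \<theta>')) * exp (- \<delta> * norm (x :: real ^ 'n)))"
      unfolding mellin_integral_def
    proof (rule Bochner_Integration.integral_norm_bound_integral)
      have "\<theta>' \<notin> closure (coamoeba f)" using disj \<theta>'(1) by blast
      then show "integrable lborel (mellin_integrand (cvec \<sigma> t) \<theta>')"
        by (rule integrable_mellin_integrand[OF \<sigma>])
      show "integrable lborel (\<lambda>x::real^'n. C * exp (- (t \<bullet> \<theta>')) * exp (- \<delta> * norm x))"
        using integrable_exp_neg_norm[OF \<delta>] by (rule integrable_mult_right)
      show "norm (mellin_integrand (cvec \<sigma> t) \<theta>' x) \<le> C * exp (- (t \<bullet> \<theta>')) * exp (- \<delta> * norm x)" for x
        by (rule bound[OF \<theta>'(1)])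
    qed
    also have "\<dots> = C * exp (- (t \<bullet> \<theta>')) * ?J"
      by (rule integral_mult_right_zero)
    also have "\<dots> = C * ?J * exp (- (t \<bullet> \<theta>)) * exp (- \<rho> * norm t)"
      by (simp add: t\<theta>' exp_diff exp_minus divide_inverse mult_ac)
    finally show "norm (mellin_integral (cvec \<sigma> t) \<theta>)
        \<le> C * ?J * exp (- (t \<bullet> \<theta>)) * exp (- \<rho> * norm t)" .
  qed
qed

text \<open>The Mellin integral is \<open>exp (- (t \<bullet> \<theta>))\<close> times the Fourier
  transform \<open>H\<close> of the integrand \<open>G\<close> at \<open>t = 0\<close>. The inverse
  power brings \<open>exp (t \<bullet> \<theta>)\<close>, so the real exponentials cancel and
  Fourier inversion of \<open>G\<close> at \<open>x0\<close> remains.\<close>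

lemma mellin_inversion:
  fixes \<theta> x0 :: "real ^ 'n"
  assumes \<sigma>: "\<sigma> \<in> interior (newton_polytope A)" and \<theta>: "\<theta> \<notin> closure (coamoeba f)"
  defines "g \<equiv> \<lambda>t. mellin_integral (cvec \<sigma> t) \<theta> * exp (cpairing (- cvec \<sigma> t) (cvec x0 \<theta>))"
  shows "integrable lborel g"
    and "integral\<^sup>L lborel g = of_real ((2 * pi) ^ CARD('n)) / f (exp_vec (cvec x0 \<theta>))"
proof -
  define G where "G = mellin_integrand (cvec \<sigma> 0) \<theta>"
  define H where "H t = (LINT x|lborel. G x * cis (t \<bullet> x))" for t
  \<comment> \<open>\<open>q\<close> is the inverse of the numerator of \<open>G x0\<close>, so
    \<open>q * G x0\<close> is \<open>1 / f\<close> at the point.\<close>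
  define q where "q = exp (- cpairing (cvec \<sigma> 0) (cvec x0 \<theta>))"
  have \<theta>': "\<theta> \<notin> coamoeba f" using \<theta> closure_subset by blast
  have [measurable]: "G \<in> borel_measurable borel" by (simp add: G_def)
  have [measurable]: "cis \<in> borel_measurable borel"
    by (intro borel_measurable_continuous_onI continuous_intros)
  have [measurable]: "H \<in> borel_measurable borel"
    unfolding H_def[abs_def] by measurable
  have cexp: "cpairing (cvec \<sigma> t) (cvec x \<theta>)
      = cpairing (cvec \<sigma> 0) (cvec x \<theta>) + of_real (- (t \<bullet> \<theta>)) + \<i> * of_real (t \<bullet> x)" for t x
    by (simp add: cpairing_cvec complex_eq_iff)
  have integrand: "mellin_integrand (cvec \<sigma> t) \<theta> x = of_real (exp (- (t \<bullet> \<theta>))) * (G x * cis (t \<bullet> x))" for t x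
  proof -
    have "exp (cpairing (cvec \<sigma> t) (cvec x \<theta>))
        = of_real (exp (- (t \<bullet> \<theta>))) * (exp (cpairing (cvec \<sigma> 0) (cvec x \<theta>)) * cis (t \<bullet> x))"
      by (subst cexp) (simp only: exp_add exp_of_real cis_conv_exp mult_ac)
    then show ?thesis by (simp add: mellin_integrand_def G_def)
  qed
  have integral: "mellin_integral (cvec \<sigma> t) \<theta> = of_real (exp (- (t \<bullet> \<theta>))) * H t" for t
  proof -
    have "mellin_integral (cvec \<sigma> t) \<theta> = (LINT x|lborel. of_real (exp (- (t \<bullet> \<theta>))) * (G x * cis (t \<bullet> x)))"
      unfolding mellin_integral_def by (intro Bochner_Integration.integral_cong refl integrand)
    then show ?thesis unfolding H_def by (simp only: integral_mult_right_zero)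
  qed
  have "exp (cpairing (- cvec \<sigma> t) (cvec x0 \<theta>)) = q * of_real (exp (t \<bullet> \<theta>)) * cis (- (t \<bullet> x0))" for t
  proof -
    have "cpairing (- cvec \<sigma> t) (cvec x0 \<theta>) = - cpairing (cvec \<sigma> t) (cvec x0 \<theta>)"
      by (simp add: cpairing_def sum_negf)
    also have "\<dots> = - cpairing (cvec \<sigma> 0) (cvec x0 \<theta>) + of_real (t \<bullet> \<theta>) + \<i> * of_real (- (t \<bullet> x0))"
      by (simp add: cexp[of t x0])
    finally show ?thesis by (simp only: q_def exp_add cis_conv_exp exp_of_real)
  qed
  then have g: "g = (\<lambda>t. q * (H t * cis (- (t \<bullet> x0))))"
    by (simp add: g_def integral fun_eq_iff exp_minus field_simps)
  have G_int: "integrable lborel G"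
    unfolding G_def by (rule integrable_mellin_integrand[OF \<sigma> \<theta>])
  \<comment> \<open>Cancelling \<open>exp (- (t \<bullet> \<theta>))\<close> in the decay estimate
    leaves a pure exponential bound for \<open>H\<close>.\<close>
  have H_int: "integrable lborel H"
  proof -
    from mellin_integral_decay[OF \<sigma> \<theta>] obtain K \<rho> where \<rho>: "\<rho> > 0"
      and decay: "\<And>t. norm (mellin_integral (cvec \<sigma> t) \<theta>) \<le> K * exp (- (t \<bullet> \<theta>)) * exp (- \<rho> * norm t)"
      by blast
    have bound: "norm (H t) \<le> K * exp (- \<rho> * norm t)" for t
    proof -
      have "exp (- (t \<bullet> \<theta>)) * norm (H t) \<le> exp (- (t \<bullet> \<theta>)) * (K * exp (- \<rho> * norm t))"
        using decay[of t] unfolding integral norm_mult by (simp add: mult_ac)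
      then show ?thesis by (rule mult_left_le_imp_le) simp
    qed
    show ?thesis
    proof (rule Bochner_Integration.integrable_bound)
      show "integrable lborel (\<lambda>t :: real ^ 'n. K * exp (- \<rho> * norm t))"
        using integrable_exp_neg_norm[OF \<rho>] by (rule integrable_mult_right)
      show "AE t in lborel. norm (H t) \<le> norm (K * exp (- \<rho> * norm t))"
        using bound by (intro AE_I2) (auto intro: order.trans[OF _ abs_ge_self])
    qed simp
  qed
  then show "integrable lborel g"
    unfolding g by (intro integrable_mult_right)
      (rule Bochner_Integration.integrable_bound[OF H_int], simp_all add: norm_mult)
  from mellin_integrand_decay[OF \<sigma> \<theta>] obtain r C \<delta> where r: "r > 0" and C: "C > 0" and \<delta>: "\<delta> > 0"
    and decay: "\<And>\<theta>' t x. \<theta>' \<in> ball \<theta> r \<Longrightarrow>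
       norm (mellin_integrand (cvec \<sigma> t) \<theta>' x) \<le> C * exp (- (t \<bullet> \<theta>')) * exp (- \<delta> * norm x)"
    by metis
  have G_bound: "norm (G x) \<le> C" for x
  proof -
    have "norm (G x) \<le> C * exp (- \<delta> * norm x)"
      using decay[of \<theta> 0 x] r by (simp add: G_def)
    also have "\<dots> \<le> C" using C \<delta> by (simp add: mult_left_le)
    finally show ?thesis .
  qed
  have "integral\<^sup>L lborel g = q * (LINT t|lborel. H t * cis (- (t \<bullet> x0)))"
    unfolding g by (rule integral_mult_right_zero)
  also have "(LINT t|lborel. H t * cis (- (t \<bullet> x0))) = of_real ((2 * pi) ^ CARD('n)) * G x0"
    using Fourier_inversion[OF G_int _ G_bound, of x0] H_int continuous_mellin_integrand[OF \<theta>']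
    by (simp add: H_def[abs_def] G_def)
  also have "q * (of_real ((2 * pi) ^ CARD('n)) * G x0)
      = of_real ((2 * pi) ^ CARD('n)) / f (exp_vec (cvec x0 \<theta>))"
    by (simp add: q_def G_def mellin_integrand_def exp_minus field_simps)
  finally show "integral\<^sup>L lborel g = of_real ((2 * pi) ^ CARD('n)) / f (exp_vec (cvec x0 \<theta>))" .
qed

end

section \<open>Assembly of the integral representation\<close>

theorem theorem4:
  fixes A :: "(int ^ 'n) set" and a :: "int ^ 'n \<Rightarrow> complex"
    and f :: "complex ^ 'n \<Rightarrow> complex" and E :: "(real ^ 'n) set"
  assumes "finite A"
    and "\<And>\<alpha>. \<alpha> \<in> A \<Longrightarrow> a \<alpha> \<noteq> 0"
    and "f = laurent_poly A a"
    and "E \<in> components (- closure (coamoeba f))"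
  shows "\<exists>M :: complex ^ 'n \<Rightarrow> complex.
    (\<forall>\<theta>\<in>E. \<forall>\<sigma>\<in>interior (newton_polytope A). \<forall>t. let s = cvec \<sigma> t in
        form_integrable (\<lambda>x. exp_vec (cvec x \<theta>)) (mellin_form f \<theta> s)
      \<and> M s = 1 / (2 * of_real pi * \<i>) ^ CARD('n)
            * form_integral (\<lambda>x. exp_vec (cvec x \<theta>)) (mellin_form f \<theta> s)
      \<and> integrable lborel (\<lambda>x. exp (cpairing s (cvec x \<theta>)) / f (exp_vec (cvec x \<theta>)))
      \<and> M s = 1 / (2 * of_real pi * \<i>) ^ CARD('n)
            * (LINT x|lborel. exp (cpairing s (cvec x \<theta>)) / f (exp_vec (cvec x \<theta>))))
  \<and> (\<forall>\<sigma>\<in>interior (newton_polytope A). \<forall>\<theta>\<in>E. \<forall>z\<in>Arg_fiber \<theta>.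
        form_integrable (\<lambda>t. cvec \<sigma> t) (\<lambda>s. M s * branch_power \<theta> z (- s))
      \<and> 1 / f z = form_integral (\<lambda>t. cvec \<sigma> t) (\<lambda>s. M s * branch_power \<theta> z (- s)))"
proof -
  interpret laurent_polynomial A a
    using assms(1,2) by unfold_locales
  note f_def = assms(3)
  have E: "E \<in> components (- closure (coamoeba (laurent_poly A a)))" using assms(3,4) by simp
  then have "E \<noteq> {}" by (rule in_components_nonempty)
  then obtain \<theta>1 where \<theta>1: "\<theta>1 \<in> E" by blast
  have E_sub: "\<theta> \<notin> closure (coamoeba (laurent_poly A a))" if "\<theta> \<in> E" for \<theta>
    using in_components_subset[OF E] that by auto
  define N where "N = (2 * of_real pi * \<i>) ^ CARD('n)"
  \<comment> \<open>The witness must not depend on \<open>\<theta>\<close>, so one point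
    \<open>\<theta>1\<close> of the nonempty component is fixed; other points give the same value
    when the real part of \<open>s\<close> is interior to the polytope.\<close>
  define M where "M s = 1 / N * mellin_integral s \<theta>1" for s
  have M: "M (cvec \<sigma> t) = 1 / N * mellin_integral (cvec \<sigma> t) \<theta>"
    if "\<theta> \<in> E" "\<sigma> \<in> interior (newton_polytope A)" for \<theta> \<sigma> t
    unfolding M_def using mellin_integral_constant_on_component[OF that(2) E \<theta>1 that(1)] by simp
  have pullback: "form_pullback (\<lambda>x. exp_vec (cvec x \<theta>)) (mellin_form f \<theta> s) = mellin_integrand s \<theta>" for \<theta> s
    by (simp add: form_pullback_mellin_form mellin_integrand_def fun_eq_iff f_def)
  have integrand: "(\<lambda>x. exp (cpairing s (cvec x \<theta>)) / f (exp_vec (cvec x \<theta>))) = mellin_integrand s \<theta>" for \<theta> s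
    by (simp add: mellin_integrand_def fun_eq_iff f_def)
  show ?thesis
  proof (intro exI[of _ M] conjI ballI allI)
    fix \<theta> \<sigma> t assume "\<theta> \<in> E" "\<sigma> \<in> interior (newton_polytope A)"
    then show "let s = cvec \<sigma> t in
        form_integrable (\<lambda>x. exp_vec (cvec x \<theta>)) (mellin_form f \<theta> s)
      \<and> M s = 1 / (2 * of_real pi * \<i>) ^ CARD('n)
            * form_integral (\<lambda>x. exp_vec (cvec x \<theta>)) (mellin_form f \<theta> s)
      \<and> integrable lborel (\<lambda>x. exp (cpairing s (cvec x \<theta>)) / f (exp_vec (cvec x \<theta>)))
      \<and> M s = 1 / (2 * of_real pi * \<i>) ^ CARD('n)
            * (LINT x|lborel. exp (cpairing s (cvec x \<theta>)) / f (exp_vec (cvec x \<theta>)))"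
      unfolding Let_def form_integrable_def form_integral_def pullback integrand N_def[symmetric]
      by (simp only: M integrable_mellin_integrand E_sub mellin_integral_def simp_thms)
  next
    fix \<sigma> \<theta> z
    assume \<sigma>: "\<sigma> \<in> interior (newton_polytope A)" and \<theta>: "\<theta> \<in> E" and "z \<in> Arg_fiber \<theta>"
    then obtain x0 where z: "z = exp_vec (cvec x0 \<theta>)" by (auto simp: Arg_fiber_def)
    let ?g = "\<lambda>t. mellin_integral (cvec \<sigma> t) \<theta> * exp (cpairing (- cvec \<sigma> t) (cvec x0 \<theta>))"
    have pb: "form_pullback (\<lambda>t. cvec \<sigma> t) (\<lambda>s. M s * branch_power \<theta> z (- s))
        = (\<lambda>t. (\<i> ^ CARD('n) / N) * ?g t)"
      by (simp add: fun_eq_iff form_pullback_cvec z branch_power_exp_vec M[OF \<theta> \<sigma>])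
    show "form_integrable (\<lambda>t. cvec \<sigma> t) (\<lambda>s. M s * branch_power \<theta> z (- s))"
      unfolding form_integrable_def pb
      by (intro integrable_mult_right mellin_inversion(1)[OF \<sigma> E_sub[OF \<theta>]])
    have "form_integral (\<lambda>t. cvec \<sigma> t) (\<lambda>s. M s * branch_power \<theta> z (- s))
        = (\<i> ^ CARD('n) / N) * (of_real ((2 * pi) ^ CARD('n)) / f z)"
      unfolding form_integral_def pb integral_mult_right_zero
        mellin_inversion(2)[OF \<sigma> E_sub[OF \<theta>]] by (simp add: z f_def)
    \<comment> \<open>The factor \<open>\<i> ^ n\<close> from \<open>ds\<close> and
      \<open>(2 * pi) ^ n\<close> from Fourier inversion together cancel \<open>N\<close>.\<close>
    also have "\<dots> = 1 / f z"
      by (simp add: N_def power_mult_distrib)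
    finally show "1 / f z = form_integral (\<lambda>t. cvec \<sigma> t) (\<lambda>s. M s * branch_power \<theta> z (- s))" ..
  qed
qed

end
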